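(* Let $k\ge 2$ be an integer and let $G$ be a graph on $n$ vertices, where $n\ge k$, with dimension of cycle space $\omega(G)$. Then $$\alpha_k(G)\ \ge\ \frac{k-1}{k}\,[\,n-\omega(G)\,].$$ Moreover, equality holds if and only if all of the following conditions hold for $G$: (i) the cycles (if any) of $G$ are pairwise vertex-disjoint; (ii) each cycle (if any) of $G$ has length congruent to $1$ modulo $k$; (iii) each connected component $T$ of $\Gamma_G$ satisfies $k\mid |V_T|$ and $T\in R^k_{|V_T|/k}$.
   Context: All graphs are finite and simple, and need not be connected. For a graph $G=(V_G,E_G)$ with $c(G)$ connected components, $\omega(G)=|E_G|-|V_G|+c(G)$ is the dimension of the cycle space of $G$. For an integer $k\ge 2$, a set $S\subseteq V_G$ is a generalized $k$-independent set if the induced subgraph $G[S]$ contains no tree on $k$ vertices as a (not necessarily induced) subgraph. The generalized $k$-independence number $\alpha_k(G)$ is the maximum size of a generalized $k$-independent set of $G$. $\Gamma_G$ denotes the graph obtained from $G$ by deleting all vertices lying on cycles of $G$ together with their incident edges (it is a possibly empty acyclic graph; if it has no vertices, condition (iii) is vacuous). For integers $k\ge 2$ and $i\ge 1$, the family $R_i^k$ of trees on $ik$ vertices is defined recursively: $R_1^k$ is the set of all trees on $k$ vertices; for $i\ge 2$, a tree $T$ lies in $R_i^k$ if there exist $T'\in R_{i-1}^k$ and a tree $T''$ on $k$ vertices such that $T$ is obtained from the disjoint union $T'\cup T''$ by adding a single edge joining a vertex of $T'$ to a vertex of $T''$. *)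

theory Defs
  imports Complex_Main "HOL-Number_Theory.Cong"
begin

text \<open>
  A graph is a pair of a vertex set and an edge set, an undirected edge being the two-element
  set of its ends. The symmetric digraphs of the AFP entry Graph_Theory are not used because
  there a walk a, b, a counts as a cycle.
\<close>

type_synonym 'a sgraph = "'a set \<times> 'a set set"

abbreviation vertices :: "'a sgraph \<Rightarrow> 'a set" where
  "vertices G \<equiv> fst G"

abbreviation edges :: "'a sgraph \<Rightarrow> 'a set set" where
  "edges G \<equiv> snd G"

definition simple_graph :: "'a sgraph \<Rightarrow> bool" where
  "simple_graph G \<longleftrightarrow> finite (vertices G) \<and> (\<forall>e\<in>edges G. e \<subseteq> vertices G \<and> card e = 2)"

definition is_subgraph :: "'a sgraph \<Rightarrow> 'a sgraph \<Rightarrow> bool" where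
  "is_subgraph H G \<longleftrightarrow> simple_graph H \<and> vertices H \<subseteq> vertices G \<and> edges H \<subseteq> edges G"

definition induced_on :: "'a sgraph \<Rightarrow> 'a set \<Rightarrow> 'a sgraph" where
  "induced_on G S = (S, {e \<in> edges G. e \<subseteq> S})"

definition connection :: "'a sgraph \<Rightarrow> ('a \<times> 'a) set" where
  "connection G = {(u, v). u \<in> vertices G \<and> v \<in> vertices G \<and> (u, v) \<in> {(x, y). {x, y} \<in> edges G}\<^sup>*}"

definition connected_graph :: "'a sgraph \<Rightarrow> bool" where
  "connected_graph G \<longleftrightarrow> vertices G \<noteq> {} \<and> (\<forall>u\<in>vertices G. \<forall>v\<in>vertices G. (u, v) \<in> connection G)"

definition graph_components :: "'a sgraph \<Rightarrow> 'a sgraph set" where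
  "graph_components G = induced_on G ` (vertices G // connection G)"

definition cycle_graph :: "'a list \<Rightarrow> 'a sgraph" where
  "cycle_graph vs =
     (set vs, {{vs ! i, vs ! (Suc i mod length vs)} | i. i < length vs})"

text \<open>
  Cycles are subgraphs rather than closed walks, so that rotating or reversing the vertex list
  does not give a different cycle.
\<close>

definition cycles_of :: "'a sgraph \<Rightarrow> 'a sgraph set" where
  "cycles_of G = {C. is_subgraph C G \<and> (\<exists>vs. 3 \<le> length vs \<and> distinct vs \<and> C = cycle_graph vs)}"

definition is_tree :: "'a sgraph \<Rightarrow> bool" where
  "is_tree T \<longleftrightarrow> simple_graph T \<and> connected_graph T \<and> cycles_of T = {}"

definition cyclomatic :: "'a sgraph \<Rightarrow> int" where
  "cyclomatic G = int (card (edges G)) - int (card (vertices G)) + int (card (graph_components G))"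

definition gen_independent :: "nat \<Rightarrow> 'a sgraph \<Rightarrow> 'a set \<Rightarrow> bool" where
  "gen_independent k G S \<longleftrightarrow> S \<subseteq> vertices G \<and>
     \<not> (\<exists>T. is_tree T \<and> card (vertices T) = k \<and> is_subgraph T (induced_on G S))"

definition gen_independence_number :: "nat \<Rightarrow> 'a sgraph \<Rightarrow> nat" where
  "gen_independence_number k G = Max {card S | S. gen_independent k G S}"

definition off_cycle_graph :: "'a sgraph \<Rightarrow> 'a sgraph" where
  "off_cycle_graph G = induced_on G (vertices G - (\<Union>C\<in>cycles_of G. vertices C))"

text \<open>
  The families \<open>R\<^sub>i\<^sup>k\<close>, as labelled trees: the disjoint union is a union of graphs with
  disjoint vertex sets. No isomorphism is needed, since any tree obtained in this way contains
  both parts as subgraphs.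
\<close>

inductive R_family :: "nat \<Rightarrow> nat \<Rightarrow> 'a sgraph \<Rightarrow> bool" for k :: nat where
  base: "is_tree T \<Longrightarrow> card (vertices T) = k \<Longrightarrow> R_family k 1 T"
| step: "R_family k i T' \<Longrightarrow> is_tree T'' \<Longrightarrow> card (vertices T'') = k \<Longrightarrow>
         vertices T' \<inter> vertices T'' = {} \<Longrightarrow> u \<in> vertices T' \<Longrightarrow> v \<in> vertices T'' \<Longrightarrow>
         R_family k (Suc i)
           (vertices T' \<union> vertices T'', insert {u, v} (edges T' \<union> edges T''))"

end

theory Submission
  imports Defs
begin

text \<open>
  Write \<open>n\<close> for the number of vertices and \<open>\<omega>\<close> for the cyclomatic number.

  For the lower bound, delete a vertex \<open>v\<close> of a cycle: \<open>n\<close> drops by one and \<open>\<omega>\<close> by at least one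
  (\<open>cyclomatic_del_cycle_vertex\<close>), so \<open>n - \<omega>\<close> does not drop, and every generalized independent set of
  \<open>G - v\<close> is one of \<open>G\<close>. Induction leads to forests. In a forest a smallest
  branch with at least \<open>k\<close> vertices falls apart into pieces of fewer than \<open>k\<close> vertices when its root is
  removed; keeping all of the branch but the root and recursing on the rest loses one vertex for
  at least \<open>k\<close> vertices (\<open>forest_bound\<close>).

  If equality holds, each of these steps is tight. In a forest all the branches split off have exactly
  \<open>k\<close> vertices, and gluing them back one at a time is the recursion that defines \<open>R\<^sub>i\<^sup>k\<close>
  (\<open>R_family_add_branch\<close>). If two cycles met, removing a vertex where they part would lower \<open>\<omega>\<close> by at least two
  and make the bound strict (\<open>intersecting_cycles\<close>). A component of \<open>\<Gamma>\<^sub>G\<close> is attached to a given cycle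
  at no more than one vertex; after deletion of that vertex it is a component of
  the \<open>\<Gamma>\<close>-graph of the remaining graph, so it inherits membership in the family (\<open>off_cycle_component_survives\<close>). Finally, breaking a
  cycle \<open>C\<close> moves its other \<open>|C| - 1\<close> vertices into the \<open>\<Gamma>\<close>-graph. The orders of the
  \<open>\<Gamma>\<close>-graph before and after are both multiples of \<open>k\<close>, hence so is \<open>|C| - 1\<close> (\<open>extremal_step\<close>).

  Conversely, if the three conditions hold, the vertices are partitioned into the cycles and into trees
  of order \<open>k\<close>. A generalized independent set misses a vertex of each such tree, and at least \<open>q + 1\<close>
  vertices of a cycle of length \<open>q k + 1\<close> (\<open>cycle_gen_independent\<close>). Since \<open>\<omega>\<close> never exceeds the number of cycles
  (\<open>cyclomatic_le_card_cycles\<close>), adding up gives the matching upper bound.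
\<close>

section \<open>Reachability and components\<close>

definition adj :: "'a sgraph \<Rightarrow> ('a \<times> 'a) set" where
  "adj G = {(x, y). {x, y} \<in> edges G}"

text \<open>
  The components of \<open>G\<close> are the sets of this form for vertices \<open>x\<close>. Depending on the edges only, they
  can be compared between graphs with different vertex sets.
\<close>

definition reach :: "'a sgraph \<Rightarrow> 'a \<Rightarrow> 'a set" where
  "reach G x = {y. (x, y) \<in> (adj G)\<^sup>*}"

abbreviation del_edges :: "'a sgraph \<Rightarrow> 'a set set \<Rightarrow> 'a sgraph" where
  "del_edges G F \<equiv> (vertices G, edges G - F)"

abbreviation del_vertex :: "'a sgraph \<Rightarrow> 'a \<Rightarrow> 'a sgraph" where
  "del_vertex G v \<equiv> induced_on G (vertices G - {v})"

lemma sym_adj: "sym (adj G)"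
  by (auto simp: sym_def adj_def insert_commute)

lemma reach_refl [simp]: "x \<in> reach G x"
  by (simp add: reach_def)

lemma reach_sym: "y \<in> reach G x \<Longrightarrow> x \<in> reach G y"
  using sym_rtrancl[OF sym_adj[of G]] by (auto simp: reach_def sym_def)

lemma reach_trans: "y \<in> reach G x \<Longrightarrow> z \<in> reach G y \<Longrightarrow> z \<in> reach G x"
  by (auto simp: reach_def)

lemma reach_step: "y \<in> reach G x \<Longrightarrow> {y, z} \<in> edges G \<Longrightarrow> z \<in> reach G x"
  by (auto simp: reach_def adj_def intro: rtrancl_into_rtrancl)

lemma reach_eq: "y \<in> reach G x \<Longrightarrow> reach G y = reach G x"
  by (meson reach_sym reach_trans subsetI subset_antisym)

lemma reach_subset_closed:
  assumes "x \<in> A" and "\<And>y z. y \<in> A \<Longrightarrow> {y, z} \<in> edges G \<Longrightarrow> z \<in> A"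
  shows "reach G x \<subseteq> A"
proof
  fix y assume "y \<in> reach G x"
  then have "(x, y) \<in> (adj G)\<^sup>*" by (simp add: reach_def)
  then show "y \<in> A"
    by (induction rule: rtrancl_induct) (use assms in \<open>auto simp: adj_def\<close>)
qed

lemma reach_mono: "edges H \<subseteq> edges G \<Longrightarrow> reach H x \<subseteq> reach G x"
  by (rule reach_subset_closed) (simp, metis reach_step subsetD)

lemma edgeE:
  assumes "simple_graph G" "e \<in> edges G"
  obtains u v where "e = {u, v}" "u \<noteq> v" "u \<in> vertices G" "v \<in> vertices G"
  using assms unfolding simple_graph_def by (metis card_2_iff insert_subset)

lemma edge_ends:
  assumes "simple_graph G" "{u, v} \<in> edges G"
  shows "u \<in> vertices G" "v \<in> vertices G" "u \<noteq> v"
proof -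
  have "{u, v} \<subseteq> vertices G" "card {u, v} = 2"
    using assms unfolding simple_graph_def by blast+
  then show "u \<in> vertices G" "v \<in> vertices G" "u \<noteq> v" by auto
qed

lemma finite_edges: "simple_graph G \<Longrightarrow> finite (edges G)"
  by (rule finite_subset[of _ "Pow (vertices G)"]) (auto simp: simple_graph_def)

lemma finite_vertices: "simple_graph G \<Longrightarrow> finite (vertices G)"
  by (simp add: simple_graph_def)

lemma simple_del_edges: "simple_graph G \<Longrightarrow> simple_graph (del_edges G F)"
  by (auto simp: simple_graph_def)

lemma simple_induced: "simple_graph G \<Longrightarrow> W \<subseteq> vertices G \<Longrightarrow> simple_graph (induced_on G W)"
  by (auto simp: simple_graph_def induced_on_def intro: finite_subset)

lemma vertices_induced [simp]: "vertices (induced_on G W) = W"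
  by (simp add: induced_on_def)

lemma edges_induced: "edges (induced_on G W) = {e \<in> edges G. e \<subseteq> W}"
  by (simp add: induced_on_def)

lemma induced_induced: "S \<subseteq> W \<Longrightarrow> induced_on (induced_on G W) S = induced_on G S"
  by (auto simp: induced_on_def)

lemma induced_all: "simple_graph G \<Longrightarrow> induced_on G (vertices G) = G"
  by (cases G) (auto simp: induced_on_def simple_graph_def)

lemma reach_in_vertices:
  assumes "simple_graph G" "x \<in> vertices G"
  shows "reach G x \<subseteq> vertices G"
  by (rule reach_subset_closed[OF assms(2)]) (rule edge_ends(2)[OF assms(1)])

lemma connection_iff: "(x, y) \<in> connection G \<longleftrightarrow> x \<in> vertices G \<and> y \<in> vertices G \<and> y \<in> reach G x"
  by (simp add: connection_def reach_def adj_def)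

lemma quotient_connection:
  assumes "simple_graph G"
  shows "vertices G // connection G = reach G ` vertices G"
proof -
  have "connection G `` {x} = reach G x" if "x \<in> vertices G" for x
    using that reach_in_vertices[OF assms that] unfolding set_eq_iff Image_singleton_iff connection_iff by blast
  then have "(\<lambda>x. connection G `` {x}) ` vertices G = reach G ` vertices G"
    by (rule image_cong[OF refl])
  then show ?thesis unfolding quotient_def UNION_singleton_eq_range .
qed

lemma graph_components_eq:
  assumes "simple_graph G"
  shows "graph_components G = (\<lambda>x. induced_on G (reach G x)) ` vertices G"
  unfolding graph_components_def quotient_connection[OF assms] image_image ..

lemma card_graph_components:
  assumes "simple_graph G"
  shows "card (graph_components G) = card (reach G ` vertices G)"
  unfolding graph_components_def quotient_connection[OF assms]
  by (rule card_image) (rule inj_onI, metis vertices_induced)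

lemma connected_graph_iff:
  "connected_graph G \<longleftrightarrow> vertices G \<noteq> {} \<and> (\<forall>u\<in>vertices G. vertices G \<subseteq> reach G u)"
  by (auto simp: connected_graph_def connection_iff)

lemma connected_graphI:
  assumes "x \<in> vertices G" "vertices G \<subseteq> reach G x"
  shows "connected_graph G"
  unfolding connected_graph_iff using assms reach_eq[of _ G x] by blast

lemma connected_graph_mono:
  assumes "connected_graph H" "vertices H = vertices G" "edges H \<subseteq> edges G"
  shows "connected_graph G"
  using assms reach_mono[OF assms(3)] unfolding connected_graph_iff by blast

text \<open>
  Adding an edge merges the components of its two ends and leaves every other component alone. Both
  counts of components under edge deletion, for bridges and for other edges, come from this formula.
\<close>

lemma reach_insert_edge:
  assumes "{u, v} \<in> edges G"
  shows "reach G x = (let G' = del_edges G {{u, v}} in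
    if u \<in> reach G' x \<or> v \<in> reach G' x then reach G' u \<union> reach G' v else reach G' x)"
proof -
  define G' where "G' = del_edges G {{u, v}}"
  have sub: "reach G' y \<subseteq> reach G y" for y
    by (rule reach_mono) (auto simp: G'_def)
  have uv: "v \<in> reach G u"
    using assms reach_step reach_refl by metis
  have step: "{y, z} \<in> edges G' \<or> {y, z} = {u, v}" if "{y, z} \<in> edges G" for y z
    using that by (auto simp: G'_def)
  have un: "reach G x = reach G' u \<union> reach G' v" if "u \<in> reach G' x \<or> v \<in> reach G' x"
  proof
    show "reach G x \<subseteq> reach G' u \<union> reach G' v"
    proof (rule reach_subset_closed)
      show "x \<in> reach G' u \<union> reach G' v" using that reach_sym[of _ G' x] by blast
    next
      fix y z assume "y \<in> reach G' u \<union> reach G' v" "{y, z} \<in> edges G"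
      then show "z \<in> reach G' u \<union> reach G' v"
        using step[of y z] reach_step[of y G' _ z] by (auto simp: doubleton_eq_iff)
    qed
    have "u \<in> reach G x" "v \<in> reach G x"
      using that subsetD[OF sub] uv reach_trans[OF _ uv] reach_trans[OF _ reach_sym[OF uv]] by auto
    then show "reach G' u \<union> reach G' v \<subseteq> reach G x"
      using sub[of u] sub[of v] reach_eq[of _ G x] by blast
  qed
  have no: "reach G x = reach G' x" if "\<not> (u \<in> reach G' x \<or> v \<in> reach G' x)"
  proof
    show "reach G x \<subseteq> reach G' x"
    proof (rule reach_subset_closed)
      fix y z assume "y \<in> reach G' x" "{y, z} \<in> edges G"
      then show "z \<in> reach G' x"
        using step[of y z] that reach_step[of y G' x z] by (auto simp: doubleton_eq_iff)
    qed simp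
  qed (rule sub)
  show ?thesis using un no by (simp add: Let_def G'_def)
qed

lemma reach_del_nonbridge:
  assumes "{u, v} \<in> edges G" "v \<in> reach (del_edges G {{u, v}}) u"
  shows "reach (del_edges G {{u, v}}) x = reach G x"
proof -
  note r = reach_insert_edge[OF assms(1), of x, unfolded Let_def]
  have *: "reach (del_edges G {{u, v}}) v = reach (del_edges G {{u, v}}) u"
    using assms(2) by (rule reach_eq)
  show ?thesis
  proof (cases "u \<in> reach (del_edges G {{u, v}}) x \<or> v \<in> reach (del_edges G {{u, v}}) x")
    case True
    then have "reach (del_edges G {{u, v}}) u = reach (del_edges G {{u, v}}) x"
      using * reach_eq by metis
    then show ?thesis using r True * by simp
  next
    case False
    then show ?thesis using r by simp
  qed
qed

section \<open>Edges on cycles\<close>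

text \<open>
  Extending a path by one edge either keeps it simple or revisits one of its vertices, in which case
  the path is cut off there.
\<close>

lemma distinct_path:
  assumes "y \<in> reach G x"
  shows "\<exists>xs. xs \<noteq> [] \<and> distinct xs \<and> hd xs = x \<and> last xs = y \<and>
    (\<forall>i. Suc i < length xs \<longrightarrow> {xs ! i, xs ! Suc i} \<in> edges G)"
proof -
  have "(x, y) \<in> (adj G)\<^sup>*" using assms by (simp add: reach_def)
  then show ?thesis
  proof (induction rule: rtrancl_induct)
    case base
    show ?case by (rule exI[of _ "[x]"]) simp
  next
    case (step y z)
    then obtain xs where xs: "xs \<noteq> []" "distinct xs" "hd xs = x" "last xs = y"
      "\<forall>i. Suc i < length xs \<longrightarrow> {xs ! i, xs ! Suc i} \<in> edges G" by blast
    have yz: "{y, z} \<in> edges G" using step(2) by (simp add: adj_def)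
    show ?case
    proof (cases "z \<in> set xs")
      case True
      then obtain j where j: "j < length xs" "xs ! j = z" by (auto simp: in_set_conv_nth)
      have "last (take (Suc j) xs) = z" using j by (simp add: take_Suc_conv_app_nth)
      moreover have "hd (take (Suc j) xs) = x" using xs by (cases xs) auto
      ultimately show ?thesis
        using xs by (intro exI[of _ "take (Suc j) xs"]) auto
    next
      case False
      show ?thesis
      proof (rule exI[of _ "xs @ [z]"], intro conjI allI impI)
        fix i assume i: "Suc i < length (xs @ [z])"
        show "{(xs @ [z]) ! i, (xs @ [z]) ! Suc i} \<in> edges G"
        proof (cases "Suc i < length xs")
          case True
          then show ?thesis using xs by (auto simp: nth_append)
        next
          case False
          then have "Suc i = length xs" using i by simp
          then have "xs ! i = y" using xs by (metis diff_Suc_1 last_conv_nth)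
          then show ?thesis using yz \<open>Suc i = length xs\<close> by (auto simp: nth_append)
        qed
      qed (use xs False in auto)
    qed
  qed
qed

text \<open>
  A simple path between the ends that avoids the edge is closed by the edge to a cycle. This is the only
  way in which cycles are constructed below.
\<close>

lemma nonbridge_on_cycle:
  assumes G: "simple_graph G" and e: "{u, v} \<in> edges G"
    and r: "v \<in> reach (del_edges G {{u, v}}) u"
  shows "\<exists>C\<in>cycles_of G. {u, v} \<in> edges C"
proof -
  obtain xs where xs: "xs \<noteq> []" "distinct xs" "hd xs = u" "last xs = v"
    "\<And>i. Suc i < length xs \<Longrightarrow> {xs ! i, xs ! Suc i} \<in> edges G - {{u, v}}"
    using distinct_path[OF r] by auto
  have uv: "u \<noteq> v" using edge_ends[OF G e] by simp
  have h: "xs ! 0 = u" "xs ! (length xs - 1) = v" using xs by (simp_all add: hd_conv_nth last_conv_nth)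
  have "length xs \<noteq> 0" "length xs \<noteq> Suc 0" using h uv xs(1) by auto
  moreover have "length xs \<noteq> 2" using xs(5)[of 0] h by auto
  ultimately have len: "3 \<le> length xs" by linarith
  define C where "C = cycle_graph xs"
  have ed: "{xs ! i, xs ! (Suc i mod length xs)} \<in> edges G" if "i < length xs" for i
  proof (cases "Suc i < length xs")
    case True
    then show ?thesis using xs(5)[of i] by simp
  next
    case False
    then have "Suc i = length xs" using that by simp
    then show ?thesis using h e by (auto simp: insert_commute simp flip: \<open>Suc i = length xs\<close>)
  qed
  then have sub: "edges C \<subseteq> edges G" by (auto simp: C_def cycle_graph_def)
  have "set xs \<subseteq> vertices G"
  proof
    fix x assume "x \<in> set xs"
    then obtain i where "i < length xs" "x = xs ! i" by (auto simp: in_set_conv_nth)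
    then show "x \<in> vertices G" using ed edge_ends(1)[OF G] by blast
  qed
  moreover have "simple_graph C"
    using sub G len by (auto simp: C_def cycle_graph_def simple_graph_def intro!: nth_mem mod_less_divisor)
  ultimately have "is_subgraph C G" using sub by (auto simp: is_subgraph_def C_def cycle_graph_def)
  then have "C \<in> cycles_of G" using len xs(2) by (auto simp: cycles_of_def C_def)
  moreover have "{u, v} \<in> edges C"
  proof -
    have "Suc (length xs - 1) = length xs" using len by simp
    then have "{u, v} = {xs ! (length xs - 1), xs ! (Suc (length xs - 1) mod length xs)}"
      using h by auto
    moreover have "length xs - 1 < length xs" using len by simp
    ultimately show ?thesis unfolding C_def cycle_graph_def snd_conv by blast
  qed
  ultimately show ?thesis by blast
qed

lemma cycle_edges_inj:
  assumes "3 \<le> length vs" "distinct vs"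
  shows "inj_on (\<lambda>i. {vs ! i, vs ! (Suc i mod length vs)}) {..<length vs}"
proof (rule inj_onI)
  fix i j
  assume ij: "i \<in> {..<length vs}" "j \<in> {..<length vs}"
    and eq: "{vs ! i, vs ! (Suc i mod length vs)} = {vs ! j, vs ! (Suc j mod length vs)}"
  have n: "vs ! a = vs ! b \<longleftrightarrow> a = b" if "a < length vs" "b < length vs" for a b
    using that assms(2) nth_eq_iff_index_eq by blast
  have m: "Suc i mod length vs < length vs" "Suc j mod length vs < length vs"
    using assms by (auto intro: mod_less_divisor)
  have "i = j \<or> i = Suc j mod length vs \<and> Suc i mod length vs = j"
    using eq ij m by (auto simp: doubleton_eq_iff n)
  then show "i = j"
    using ij assms(1) by (auto simp: mod_Suc split: if_splits)
qed

text \<open>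
  Indices are taken modulo the length, so that a walk may pass the end of the vertex list.
\<close>

lemma cycle_walk:
  assumes "vs \<noteq> []" and i: "\<And>m. m < j \<Longrightarrow> {vs ! ((i + m) mod length vs), vs ! ((i + Suc m) mod length vs)} \<in> edges H"
  shows "vs ! ((i + j) mod length vs) \<in> reach H (vs ! (i mod length vs))"
  using i
proof (induction j)
  case (Suc j)
  then show ?case by (meson less_Suc_eq reach_step)
qed simp

lemma cycle_edge:
  assumes "vs \<noteq> []"
  shows "{vs ! (m mod length vs), vs ! (Suc m mod length vs)} \<in> edges (cycle_graph vs)"
  using assms by (auto simp: cycle_graph_def mod_Suc_eq intro!: exI[of _ "m mod length vs"])

lemma vertices_cycle [simp]: "vertices (cycle_graph vs) = set vs"
  by (simp add: cycle_graph_def)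

text \<open>
  Starting behind the edge and going once around the cycle leads back to its other end; the edge
  itself is not met on the way because distinct indices carry distinct edges.
\<close>

lemma cycle_edge_nonbridge:
  assumes C: "C \<in> cycles_of G" and e: "{u, v} \<in> edges C"
  shows "v \<in> reach (del_edges C {{u, v}}) u"
proof -
  obtain vs where vs: "3 \<le> length vs" "distinct vs" "C = cycle_graph vs"
    using C by (auto simp: cycles_of_def)
  define l where "l = length vs"
  obtain i where i: "i < l" "{u, v} = {vs ! i, vs ! (Suc i mod l)}"
    using e by (auto simp: vs(3) cycle_graph_def l_def)
  have l: "3 \<le> l" using vs l_def by simp
  have "vs ! ((Suc i + (l - 1)) mod l) \<in> reach (del_edges C {{u, v}}) (vs ! (Suc i mod l))"
    unfolding l_def
  proof (rule cycle_walk)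
    show "vs \<noteq> []" using vs by auto
  next
    fix m assume m: "m < length vs - 1"
    define p where "p = (Suc i + m) mod l"
    have p: "p < l" using l by (simp add: p_def)
    have "p \<noteq> i"
      using i(1) m by (auto simp: p_def l_def mod_if split: if_splits)
    have s: "(Suc i + Suc m) mod l = Suc p mod l" by (simp add: p_def mod_Suc_eq)
    have "{vs ! p, vs ! (Suc p mod l)} \<noteq> {u, v}"
      using cycle_edges_inj[OF vs(1,2)] p i \<open>p \<noteq> i\<close> unfolding l_def inj_on_def by auto
    moreover have "{vs ! p, vs ! (Suc p mod l)} \<in> edges C"
      using p by (auto simp: vs(3) cycle_graph_def l_def)
    ultimately show "{vs ! ((Suc i + m) mod length vs), vs ! ((Suc i + Suc m) mod length vs)}
        \<in> edges (del_edges C {{u, v}})"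
      using s by (simp add: p_def l_def)
  qed
  moreover have "(Suc i + (l - 1)) mod l = i" using i l by simp
  ultimately have "vs ! i \<in> reach (del_edges C {{u, v}}) (vs ! (Suc i mod l))" by simp
  with i(2) show ?thesis by (auto simp: doubleton_eq_iff intro: reach_sym)
qed

lemma cycle_facts:
  assumes "C \<in> cycles_of G"
  shows "connected_graph C" "simple_graph C" "vertices C \<subseteq> vertices G" "edges C \<subseteq> edges G"
    "card (edges C) = card (vertices C)" "\<And>v. v \<in> vertices C \<Longrightarrow> \<exists>e\<in>edges C. v \<in> e"
proof -
  obtain vs where vs: "3 \<le> length vs" "distinct vs" "C = cycle_graph vs"
    using assms by (auto simp: cycles_of_def)
  have ne: "vs \<noteq> []" using vs by auto
  show "simple_graph C" "vertices C \<subseteq> vertices G" "edges C \<subseteq> edges G"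
    using assms by (auto simp: cycles_of_def is_subgraph_def)
  have "edges C = (\<lambda>i. {vs ! i, vs ! (Suc i mod length vs)}) ` {..<length vs}"
    by (auto simp: vs(3) cycle_graph_def)
  then show "card (edges C) = card (vertices C)"
    using card_image[OF cycle_edges_inj[OF vs(1,2)]] vs by (simp add: distinct_card)
  show "connected_graph C"
  proof (rule connected_graphI)
    show "vs ! 0 \<in> vertices C" using ne by (simp add: vs(3))
    show "vertices C \<subseteq> reach C (vs ! 0)"
    proof
      fix x assume "x \<in> vertices C"
      then obtain j where j: "j < length vs" "x = vs ! j" by (auto simp: vs(3) in_set_conv_nth)
      have "vs ! ((0 + j) mod length vs) \<in> reach C (vs ! (0 mod length vs))"
        by (rule cycle_walk[OF ne]) (use cycle_edge[OF ne] vs(3) in simp)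
      then show "x \<in> reach C (vs ! 0)" using j by simp
    qed
  qed
  show "\<exists>e\<in>edges C. v \<in> e" if v: "v \<in> vertices C" for v
  proof -
    obtain j where j: "j < length vs" "v = vs ! j" using v by (auto simp: vs(3) in_set_conv_nth)
    show ?thesis using cycle_edge[OF ne, of j] j vs(3) by auto
  qed
qed

lemma cycle_sub:
  assumes "C \<in> cycles_of G" "vertices C \<subseteq> vertices H" "edges C \<subseteq> edges H"
  shows "C \<in> cycles_of H"
  using assms by (auto simp: cycles_of_def is_subgraph_def)

lemma finite_cycles:
  assumes "simple_graph G"
  shows "finite (cycles_of G)"
proof (rule finite_subset)
  show "cycles_of G \<subseteq> Pow (vertices G) \<times> Pow (edges G)"
  proof
    fix C assume "C \<in> cycles_of G"
    then show "C \<in> Pow (vertices G) \<times> Pow (edges G)"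
      using cycle_facts(3,4)[of C G] by (simp add: mem_Times_iff)
  qed
  show "finite (Pow (vertices G) \<times> Pow (edges G))"
    using assms by (simp add: finite_edges finite_vertices)
qed

section \<open>The cyclomatic number under deletions\<close>

lemma cyclomatic_eq:
  "simple_graph G \<Longrightarrow> cyclomatic G =
    int (card (edges G)) - int (card (vertices G)) + int (card (reach G ` vertices G))"
  by (simp add: cyclomatic_def card_graph_components)

lemma card_reach_bridge:
  assumes G: "simple_graph G" and e: "{u, v} \<in> edges G"
    and br: "v \<notin> reach (del_edges G {{u, v}}) u"
  shows "card (reach (del_edges G {{u, v}}) ` vertices G) = card (reach G ` vertices G) + 1"
proof -
  define G' where "G' = del_edges G {{u, v}}"
  define A where "A = reach G' u"
  define B where "B = reach G' v"
  define R where "R = reach G' ` vertices G"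
  note r = reach_insert_edge[OF e, unfolded Let_def, folded G'_def, folded A_def B_def]
  have uv: "u \<in> vertices G" "v \<in> vertices G" using edge_ends[OF G e] by auto
  have AB: "A \<noteq> B" using br by (auto simp: A_def B_def G'_def)
  have Au: "reach G' x = A" if "u \<in> reach G' x" for x using reach_eq[OF that] by (simp add: A_def)
  have Bv: "reach G' x = B" if "v \<in> reach G' x" for x using reach_eq[OF that] by (simp add: B_def)
  have eq: "reach G ` vertices G = insert (A \<union> B) (R - {A, B})"
  proof (intro subset_antisym subsetI)
    fix X assume "X \<in> reach G ` vertices G"
    then obtain x where x: "x \<in> vertices G" "X = reach G x" by auto
    show "X \<in> insert (A \<union> B) (R - {A, B})"
    proof (cases "u \<in> reach G' x \<or> v \<in> reach G' x")
      case True
      then show ?thesis using r[of x] x by simp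
    next
      case False
      moreover have "u \<in> A" "v \<in> B" by (simp_all add: A_def B_def)
      ultimately have "reach G' x \<noteq> A" "reach G' x \<noteq> B" by metis+
      moreover have "X = reach G' x" using False r[of x] x by simp
      ultimately show ?thesis using x(1) unfolding R_def by blast
    qed
  next
    fix X assume "X \<in> insert (A \<union> B) (R - {A, B})"
    then consider "X = A \<union> B" | x where "x \<in> vertices G" "X = reach G' x" "X \<noteq> A" "X \<noteq> B"
      unfolding R_def by blast
    then show "X \<in> reach G ` vertices G"
    proof cases
      case 1
      then have "X = reach G u" using r[of u] by simp
      then show ?thesis using uv by blast
    next
      case 2
      then have "X = reach G x" using r[of x] Au[of x] Bv[of x] by metis
      then show ?thesis using 2(1) by blast
    qed
  qed
  have new: "A \<union> B \<notin> R - {A, B}"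
  proof
    assume "A \<union> B \<in> R - {A, B}"
    then obtain x where x: "A \<union> B = reach G' x" "A \<union> B \<noteq> A" unfolding R_def by blast
    have "u \<in> A" by (simp add: A_def)
    then show False using Au[of x] x by blast
  qed
  have fin: "finite R" using finite_vertices[OF G] by (simp add: R_def)
  have sub: "{A, B} \<subseteq> R" using uv unfolding R_def A_def B_def by blast
  have "card {A, B} = 2" using AB by simp
  moreover have "card (R - {A, B}) = card R - card {A, B}"
    by (rule card_Diff_subset) (use sub in auto)
  moreover have "card {A, B} \<le> card R" by (rule card_mono[OF fin sub])
  moreover have "card (reach G ` vertices G) = Suc (card (R - {A, B}))"
    unfolding eq using new fin by simp
  ultimately show ?thesis unfolding R_def G'_def by linarith
qed

lemma card_del_edge: "simple_graph G \<Longrightarrow> e \<in> edges G \<Longrightarrow>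
    int (card (edges G - {e})) = int (card (edges G)) - 1"
  using card_Suc_Diff1[OF finite_edges] by fastforce

lemma cyclomatic_del_nonbridge:
  assumes G: "simple_graph G" and e: "{u, v} \<in> edges G"
    and r: "v \<in> reach (del_edges G {{u, v}}) u"
  shows "cyclomatic (del_edges G {{u, v}}) = cyclomatic G - 1"
  using card_del_edge[OF G e] reach_del_nonbridge[OF e r]
  by (simp add: cyclomatic_eq G simple_del_edges)

lemma cyclomatic_del_bridge:
  assumes G: "simple_graph G" and e: "{u, v} \<in> edges G"
    and r: "v \<notin> reach (del_edges G {{u, v}}) u"
  shows "cyclomatic (del_edges G {{u, v}}) = cyclomatic G"
  using card_del_edge[OF G e] card_reach_bridge[OF G e r]
  by (simp add: cyclomatic_eq G simple_del_edges)

lemma cyclomatic_del_edge_le: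
  assumes G: "simple_graph G"
  shows "cyclomatic (del_edges G {e}) \<le> cyclomatic G"
proof (cases "e \<in> edges G")
  case True
  then obtain u v where "e = {u, v}" using edgeE[OF G] by metis
  then show ?thesis using True cyclomatic_del_nonbridge[OF G] cyclomatic_del_bridge[OF G]
    by (cases "v \<in> reach (del_edges G {{u, v}}) u") auto
qed simp

lemma cyclomatic_del_edges_le:
  assumes "simple_graph G"
  shows "cyclomatic (del_edges G F) \<le> cyclomatic G"
proof -
  have "cyclomatic (del_edges G F) \<le> cyclomatic G" if "finite F" for F
    using that
  proof (induction F rule: finite_induct)
    case (insert e F)
    have "cyclomatic (del_edges (del_edges G F) {e}) \<le> cyclomatic (del_edges G F)"
      by (rule cyclomatic_del_edge_le[OF simple_del_edges[OF assms]])
    moreover have "del_edges (del_edges G F) {e} = del_edges G (insert e F)" by auto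
    ultimately show ?case using insert.IH by simp
  qed simp
  from this[of "F \<inter> edges G"] finite_edges[OF assms]
  have "cyclomatic (del_edges G (F \<inter> edges G)) \<le> cyclomatic G" by simp
  moreover have "del_edges G (F \<inter> edges G) = del_edges G F" by auto
  ultimately show ?thesis by simp
qed

lemma cyclomatic_edgeless:
  assumes "simple_graph G" "edges G = {}"
  shows "cyclomatic G = 0"
proof -
  have "reach G x = {x}" for x
    using reach_subset_closed[of x "{x}" G] assms by auto
  then have "inj_on (reach G) (vertices G)" by (auto simp: inj_on_def)
  then show ?thesis using assms by (simp add: cyclomatic_eq card_image)
qed

lemma cyclomatic_nonneg:
  assumes "simple_graph G"
  shows "0 \<le> cyclomatic G"
  using cyclomatic_del_edges_le[OF assms, of "edges G"]
    cyclomatic_edgeless[OF simple_del_edges[OF assms, of "edges G"]] by simp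

text \<open>
  Delete the edges one at a time. An edge that lowers the cyclomatic number is no bridge, so it lies on
  a cycle, and that cycle disappears with it.
\<close>

lemma cyclomatic_le_card_cycles:
  assumes "simple_graph G"
  shows "cyclomatic G \<le> int (card (cycles_of G))"
  using assms
proof (induction "card (edges G)" arbitrary: G rule: less_induct)
  case less
  note G = less.prems
  show ?case
  proof (cases "edges G = {}")
    case True
    then show ?thesis using cyclomatic_edgeless[OF G] by simp
  next
    case False
    then obtain u v where e: "{u, v} \<in> edges G" using edgeE[OF G] by (metis ex_in_conv)
    define H where "H = del_edges G {{u, v}}"
    have H: "simple_graph H" using simple_del_edges[OF G] by (simp add: H_def)
    have "card (edges H) < card (edges G)"
      unfolding H_def snd_conv by (rule card_Diff1_less[OF finite_edges[OF G] e])
    then have IH: "cyclomatic H \<le> int (card (cycles_of H))" using less.hyps H by blast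
    have sub: "cycles_of H \<subseteq> {C \<in> cycles_of G. {u, v} \<notin> edges C}"
      by (auto simp: cycles_of_def is_subgraph_def H_def)
    note fin = finite_cycles[OF G]
    show ?thesis
    proof (cases "v \<in> reach H u")
      case True
      then obtain C where C: "C \<in> cycles_of G" "{u, v} \<in> edges C"
        using nonbridge_on_cycle[OF G e] by (auto simp: H_def)
      then have "cycles_of H \<subset> cycles_of G" using sub by blast
      then have "card (cycles_of H) < card (cycles_of G)" by (rule psubset_card_mono[OF fin])
      then show ?thesis using IH cyclomatic_del_nonbridge[OF G e] True by (simp add: H_def)
    next
      case False
      have "card (cycles_of H) \<le> card (cycles_of G)" by (rule card_mono[OF fin]) (use sub in blast)
      then show ?thesis using IH cyclomatic_del_bridge[OF G e] False by (simp add: H_def)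
    qed
  qed
qed

lemma reach_cong: "edges G = edges H \<Longrightarrow> reach G = reach H"
  by (intro ext) (simp add: reach_def adj_def)

lemma cyclomatic_del_isolated:
  assumes G: "simple_graph G" and v: "v \<in> vertices G" and iso: "\<And>e. e \<in> edges G \<Longrightarrow> v \<notin> e"
  shows "cyclomatic (del_vertex G v) = cyclomatic G"
proof -
  define H where "H = del_vertex G v"
  have H: "simple_graph H" unfolding H_def by (rule simple_induced[OF G]) auto
  have ed: "edges H = edges G"
    using iso G by (auto simp: H_def edges_induced simple_graph_def)
  have "reach G v = {v}"
    using reach_subset_closed[of v "{v}" G] iso by auto
  then have im: "reach G ` vertices G = insert {v} (reach G ` (vertices G - {v}))"
    using v by auto
  have "{v} \<notin> reach G ` (vertices G - {v})"
  proof
    assume "{v} \<in> reach G ` (vertices G - {v})"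
    then obtain x where "x \<noteq> v" "reach G x = {v}" by auto
    then show False using reach_refl[of x G] by simp
  qed
  then have "card (reach G ` vertices G) = Suc (card (reach H ` vertices H))"
    using im finite_vertices[OF G] reach_cong[OF ed] by (simp add: H_def)
  moreover have "card (vertices G) = Suc (card (vertices H))"
    using card_Suc_Diff1[OF finite_vertices[OF G] v] by (simp add: H_def)
  ultimately have "cyclomatic H = cyclomatic G" using ed by (simp add: cyclomatic_eq G H)
  then show ?thesis by (simp add: H_def)
qed

text \<open>
  Deleting a vertex amounts to deleting all its edges and then an isolated vertex. None of these steps
  raises the cyclomatic number, so any chosen part \<open>F\<close> of the edges at \<open>v\<close> gives an upper bound.
\<close>

lemma cyclomatic_del_vertex_le:
  assumes G: "simple_graph G" and v: "v \<in> vertices G" and F: "\<And>e. e \<in> F \<Longrightarrow> v \<in> e"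
  shows "cyclomatic (del_vertex G v) \<le> cyclomatic (del_edges G F)"
proof -
  define H where "H = del_edges (del_edges G F) {e. v \<in> e}"
  have H: "simple_graph H" "v \<in> vertices H" "\<And>e. e \<in> edges H \<Longrightarrow> v \<notin> e"
    unfolding H_def using v by (auto intro: simple_del_edges[OF simple_del_edges[OF G, of F], simplified])
  have "del_vertex G v = del_vertex H v"
    using F by (auto simp: H_def induced_on_def)
  then have "cyclomatic (del_vertex G v) = cyclomatic H"
    using cyclomatic_del_isolated[OF H] by simp
  also have "\<dots> \<le> cyclomatic (del_edges G F)"
    unfolding H_def by (rule cyclomatic_del_edges_le[OF simple_del_edges[OF G]])
  finally show ?thesis .
qed

lemma cyclomatic_del_cycle_edge:
  assumes G: "simple_graph G" and C: "C \<in> cycles_of G" and e: "e \<in> edges C"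
  shows "cyclomatic (del_edges G {e}) = cyclomatic G - 1"
proof -
  obtain u v where uv: "e = {u, v}" using edgeE[OF cycle_facts(2)[OF C] e] by metis
  have "reach (del_edges C {{u, v}}) u \<subseteq> reach (del_edges G {{u, v}}) u"
    by (rule reach_mono) (use cycle_facts(4)[OF C] in auto)
  then show ?thesis
    using cyclomatic_del_nonbridge[OF G, of u v] cycle_edge_nonbridge[OF C, of u v] e uv
      cycle_facts(4)[OF C] by auto
qed

lemma cyclomatic_del_cycle_vertex:
  assumes G: "simple_graph G" and C: "C \<in> cycles_of G" and v: "v \<in> vertices C"
  shows "cyclomatic (del_vertex G v) \<le> cyclomatic G - 1"
proof -
  obtain e where e: "e \<in> edges C" "v \<in> e" using cycle_facts(6)[OF C v] by blast
  have "v \<in> vertices G" using cycle_facts(3)[OF C] v by blast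
  from cyclomatic_del_vertex_le[OF G this, of "{e}"] e show ?thesis
    using cyclomatic_del_cycle_edge[OF G C e(1)] by simp
qed

text \<open>
  The edge \<open>e\<close> is deleted first, which destroys \<open>C\<close> but not \<open>D\<close>; then an edge of \<open>D\<close> at \<open>v\<close> still lies on
  a cycle, and its deletion lowers the cyclomatic number a second time.
\<close>

lemma cyclomatic_del_branching_vertex:
  assumes G: "simple_graph G" and C: "C \<in> cycles_of G" and D: "D \<in> cycles_of G"
    and v: "v \<in> vertices D" and e: "e \<in> edges C" "e \<notin> edges D" "v \<in> e"
  shows "cyclomatic (del_vertex G v) \<le> cyclomatic G - 2"
proof -
  obtain f where f: "f \<in> edges D" "v \<in> f" using cycle_facts(6)[OF D v] by blast
  have D': "D \<in> cycles_of (del_edges G {e})"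
    using D cycle_facts(3,4)[OF D] e by (intro cycle_sub[OF D]) auto
  have "v \<in> vertices G" using cycle_facts(3)[OF D] v by blast
  then have "cyclomatic (del_vertex G v) \<le> cyclomatic (del_edges G {e, f})"
    by (rule cyclomatic_del_vertex_le[OF G]) (use e f in auto)
  also have "del_edges G {e, f} = del_edges (del_edges G {e}) {f}" by auto
  also have "cyclomatic \<dots> = cyclomatic (del_edges G {e}) - 1"
    by (rule cyclomatic_del_cycle_edge[OF simple_del_edges[OF G] D' f(1)])
  also have "cyclomatic (del_edges G {e}) = cyclomatic G - 1"
    by (rule cyclomatic_del_cycle_edge[OF G C e(1)])
  finally show ?thesis by simp
qed

text \<open>
  The hypothesis says that \<open>C\<close> can never leave \<open>D\<close>; since \<open>C\<close> is connected and meets \<open>D\<close>, it stays inside.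
\<close>

lemma cycle_absorbed:
  assumes C: "C \<in> cycles_of G" and D: "D \<in> cycles_of G" and x: "x \<in> vertices C" "x \<in> vertices D"
    and e: "\<And>e y. e \<in> edges C \<Longrightarrow> y \<in> e \<Longrightarrow> y \<in> vertices D \<Longrightarrow> e \<in> edges D"
  shows "vertices C \<subseteq> vertices D \<and> edges C \<subseteq> edges D"
proof -
  have "reach C x \<subseteq> vertices D"
  proof (rule reach_subset_closed[OF x(2)])
    fix y z assume "y \<in> vertices D" "{y, z} \<in> edges C"
    then have "{y, z} \<in> edges D" using e by blast
    then show "z \<in> vertices D" using edge_ends[OF cycle_facts(2)[OF D]] by blast
  qed
  moreover have "vertices C \<subseteq> reach C x" using cycle_facts(1)[OF C] x(1) by (simp add: connected_graph_iff)
  ultimately have V: "vertices C \<subseteq> vertices D" by blast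
  have "edges C \<subseteq> edges D"
  proof
    fix f assume f: "f \<in> edges C"
    then obtain a b where "f = {a, b}" "a \<in> vertices C" using edgeE[OF cycle_facts(2)[OF C]] by metis
    then show "f \<in> edges D" using e[OF f, of a] V by blast
  qed
  with V show ?thesis by blast
qed

text \<open>
  Two different cycles with a common vertex part somewhere: otherwise each would absorb the other and
  they would be equal.
\<close>

lemma intersecting_cycles:
  assumes G: "simple_graph G" and C: "C \<in> cycles_of G" and D: "D \<in> cycles_of G"
    and ne: "C \<noteq> D" and x: "x \<in> vertices C" "x \<in> vertices D"
  shows "\<exists>v\<in>vertices C \<union> vertices D. cyclomatic (del_vertex G v) \<le> cyclomatic G - 2"
proof (rule ccontr)
  assume no: "\<not> ?thesis"
  have "vertices C \<subseteq> vertices D \<and> edges C \<subseteq> edges D"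
    by (rule cycle_absorbed[OF C D x]) (use no cyclomatic_del_branching_vertex[OF G C D] in blast)
  moreover have "vertices D \<subseteq> vertices C \<and> edges D \<subseteq> edges C"
    by (rule cycle_absorbed[OF D C x(2,1)]) (use no cyclomatic_del_branching_vertex[OF G D C] in blast)
  ultimately have "C = D" by (auto intro: prod_eqI)
  with ne show False ..
qed

section \<open>Generalized independent sets\<close>

text \<open>
  Delete edges on cycles as long as there are cycles; none of them is a bridge, so the graph stays connected.
\<close>

lemma spanning_tree:
  assumes "simple_graph G" "connected_graph G"
  shows "\<exists>T. is_tree T \<and> vertices T = vertices G \<and> edges T \<subseteq> edges G"
  using assms
proof (induction "card (edges G)" arbitrary: G rule: less_induct)
  case less
  note G = less.prems
  show ?case
  proof (cases "cycles_of G = {}")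
    case True
    then show ?thesis using G by (intro exI[of _ G]) (simp add: is_tree_def)
  next
    case False
    then obtain C where C: "C \<in> cycles_of G" by blast
    then obtain x where "x \<in> vertices C" using cycle_facts(1)[OF C] by (auto simp: connected_graph_iff)
    then obtain e where e: "e \<in> edges C" using cycle_facts(6)[OF C] by blast
    then obtain u v where uv: "e = {u, v}" using edgeE[OF cycle_facts(2)[OF C] e] by metis
    have eG: "{u, v} \<in> edges G" using e uv cycle_facts(4)[OF C] by blast
    define H where "H = del_edges G {{u, v}}"
    have "reach (del_edges C {{u, v}}) u \<subseteq> reach H u"
      unfolding H_def by (rule reach_mono) (use cycle_facts(4)[OF C] in auto)
    then have "v \<in> reach H u" using cycle_edge_nonbridge[OF C, of u v] e uv by blast
    then have "reach H = reach G" using reach_del_nonbridge[OF eG] by (auto simp: H_def)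
    then have "connected_graph H" using G(2) by (simp add: connected_graph_iff H_def)
    moreover have "simple_graph H" using simple_del_edges[OF G(1)] by (simp add: H_def)
    moreover have "card (edges H) < card (edges G)"
      unfolding H_def snd_conv by (rule card_Diff1_less[OF finite_edges[OF G(1)] eG])
    ultimately obtain T where "is_tree T" "vertices T = vertices H" "edges T \<subseteq> edges H"
      using less.hyps by blast
    then show ?thesis unfolding H_def by (metis Diff_subset fst_conv snd_conv subset_trans)
  qed
qed

text \<open>
  Spanning trees allow connected vertex sets to replace trees as the forbidden configurations. These are
  much easier to handle: to be connected is a matter of reachability, whereas acyclicity would have to be
  verified for each tree exhibited.
\<close>

lemma gen_independent_iff:
  assumes G: "simple_graph G"
  shows "gen_independent k G S \<longleftrightarrow>
    S \<subseteq> vertices G \<and> (\<forall>X\<subseteq>S. connected_graph (induced_on G X) \<longrightarrow> card X \<noteq> k)"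
proof -
  have "(\<exists>T. is_tree T \<and> card (vertices T) = k \<and> is_subgraph T (induced_on G S)) \<longleftrightarrow>
      (\<exists>X\<subseteq>S. connected_graph (induced_on G X) \<and> card X = k)" if S: "S \<subseteq> vertices G"
  proof
    assume "\<exists>T. is_tree T \<and> card (vertices T) = k \<and> is_subgraph T (induced_on G S)"
    then obtain T where T: "is_tree T" "card (vertices T) = k" "is_subgraph T (induced_on G S)"
      by blast
    have "connected_graph (induced_on G (vertices T))"
    proof (rule connected_graph_mono)
      show "connected_graph T" using T by (simp add: is_tree_def)
      show "edges T \<subseteq> edges (induced_on G (vertices T))"
        using T by (auto simp: is_subgraph_def edges_induced simple_graph_def)
    qed simp
    moreover have "vertices T \<subseteq> S" using T by (simp add: is_subgraph_def)
    ultimately show "\<exists>X\<subseteq>S. connected_graph (induced_on G X) \<and> card X = k" using T(2) by blast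
  next
    assume "\<exists>X\<subseteq>S. connected_graph (induced_on G X) \<and> card X = k"
    then obtain X where X: "X \<subseteq> S" "connected_graph (induced_on G X)" "card X = k" by blast
    have "simple_graph (induced_on G X)" using simple_induced[OF G] X(1) S by blast
    from spanning_tree[OF this X(2)] obtain T where T: "is_tree T" "vertices T = X"
      "edges T \<subseteq> edges (induced_on G X)" by auto
    then have "is_subgraph T (induced_on G S)"
      using X(1) by (auto simp: is_subgraph_def is_tree_def edges_induced)
    then show "\<exists>T. is_tree T \<and> card (vertices T) = k \<and> is_subgraph T (induced_on G S)"
      using T X(3) by blast
  qed
  then show ?thesis unfolding gen_independent_def by blast
qed

lemma finite_gen_independent: "simple_graph G \<Longrightarrow> finite {card S | S. gen_independent k G S}"
  by (rule finite_subset[of _ "card ` Pow (vertices G)"])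
    (auto simp: gen_independent_def finite_vertices)

lemma gen_independent_card_le:
  "simple_graph G \<Longrightarrow> gen_independent k G S \<Longrightarrow> card S \<le> gen_independence_number k G"
  unfolding gen_independence_number_def
  by (rule Max_ge[OF finite_gen_independent]) auto

lemma gen_independence_number_attained:
  assumes "simple_graph G"
  obtains S where "gen_independent k G S" "card S = gen_independence_number k G"
proof -
  have "gen_independent k G {}"
    using assms by (auto simp: gen_independent_iff connected_graph_iff)
  then have "{card S | S. gen_independent k G S} \<noteq> {}" by blast
  from Max_in[OF finite_gen_independent[OF assms] this] that show ?thesis
    unfolding gen_independence_number_def by auto
qed

lemma gen_independence_number_induced:
  assumes G: "simple_graph G" and W: "W \<subseteq> vertices G"
  shows "gen_independence_number k (induced_on G W) \<le> gen_independence_number k G"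
proof -
  have H: "simple_graph (induced_on G W)" by (rule simple_induced[OF G W])
  obtain S where S: "gen_independent k (induced_on G W) S"
    "card S = gen_independence_number k (induced_on G W)"
    by (rule gen_independence_number_attained[OF H])
  have "S \<subseteq> W" using S(1) by (simp add: gen_independent_def)
  then have "gen_independent k G S"
    using S(1) W by (auto simp: gen_independent_def induced_induced)
  from gen_independent_card_le[OF G this] S(2) show ?thesis by simp
qed

section \<open>Forests\<close>

lemma connected_reach: "connected_graph (induced_on G (reach G x))"
proof (rule connected_graphI)
  define I where "I = induced_on G (reach G x)"
  have "reach G x \<subseteq> reach I x \<inter> reach G x"
  proof (rule reach_subset_closed)
    fix y z assume y: "y \<in> reach I x \<inter> reach G x" "{y, z} \<in> edges G"
    then have z: "z \<in> reach G x" using reach_step[OF _ y(2)] by blast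
    then have e: "{y, z} \<in> edges I" using y by (simp add: I_def edges_induced)
    show "z \<in> reach I x \<inter> reach G x" using y(1) z reach_step[OF _ e] by blast
  qed simp
  then show "vertices (induced_on G (reach G x)) \<subseteq> reach (induced_on G (reach G x)) x"
    by (simp add: I_def)
qed simp

lemma connected_subset_reach:
  assumes "connected_graph (induced_on G Z)" "z \<in> Z" "Z \<subseteq> W"
  shows "Z \<subseteq> reach (induced_on G W) z"
proof -
  have "Z \<subseteq> reach (induced_on G Z) z" using assms by (auto simp: connected_graph_iff)
  also have "\<dots> \<subseteq> reach (induced_on G W) z"
    by (rule reach_mono) (use assms(3) in \<open>auto simp: edges_induced\<close>)
  finally show ?thesis .
qed

lemma reach_induced_subset: "reach (induced_on G W) x \<subseteq> reach G x"
  by (rule reach_mono) (auto simp: edges_induced)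

text \<open>
  A branch is a connected set \<open>X\<close> of vertices that at most one edge leaves, and this edge does so at the
  root \<open>v\<close>. It plays the part of the set of descendants of \<open>v\<close> in a rooted tree without a choice of
  root for the whole tree. The vertex \<open>w\<close> is the parent of \<open>v\<close>, if there is one.
\<close>

definition branch :: "'a sgraph \<Rightarrow> 'a set \<Rightarrow> 'a \<Rightarrow> bool" where
  "branch G X v \<longleftrightarrow> X \<subseteq> vertices G \<and> v \<in> X \<and> connected_graph (induced_on G X) \<and>
     (\<exists>w. \<forall>x\<in>X. \<forall>y. {x, y} \<in> edges G \<and> y \<notin> X \<longrightarrow> x = v \<and> y = w)"

lemma branch_component:
  assumes "simple_graph G" "x \<in> vertices G"
  shows "branch G (reach G x) x"
  unfolding branch_def
  using reach_in_vertices[OF assms] connected_reach[of G x] reach_step[of _ G x] by auto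

text \<open>
  Without its root, a branch of a forest falls apart into branches. An edge that leaves a piece \<open>Y\<close> must go
  to \<open>v\<close>, since \<open>Y\<close> is a component of \<open>X - {v}\<close> and edges leave \<open>X\<close> only from \<open>v\<close>. Two such edges would
  close a cycle through \<open>Y\<close>.
\<close>

lemma branch_child:
  assumes G: "simple_graph G" and ac: "cycles_of G = {}" and br: "branch G X v"
    and y: "y \<in> X - {v}"
  defines "Y \<equiv> reach (induced_on G (X - {v})) y"
  shows "Y \<subseteq> X - {v} \<and> (\<exists>r. branch G Y r)"
proof
  define H where "H = induced_on G (X - {v})"
  have Y: "Y = reach H y" by (simp add: Y_def H_def)
  have XV: "X \<subseteq> vertices G" using br by (simp add: branch_def)
  have H: "simple_graph H" unfolding H_def by (rule simple_induced[OF G]) (use XV in auto)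
  show YX: "Y \<subseteq> X - {v}"
    using reach_in_vertices[OF H, of y] y by (simp add: Y H_def)
  have conn: "connected_graph (induced_on G Y)"
    using connected_reach[of H y] YX by (simp add: Y H_def induced_induced)
  have to_v: "b = v" if ab: "{a, b} \<in> edges G" "a \<in> Y" "b \<notin> Y" for a b
  proof (rule ccontr)
    assume bv: "b \<noteq> v"
    have a: "a \<in> X" "a \<noteq> v" using ab(2) YX by auto
    then have "b \<in> X" using br ab(1) unfolding branch_def by blast
    then have "{a, b} \<in> edges H" using a bv ab(1) by (simp add: H_def edges_induced)
    from reach_step[OF _ this, of y] show False using ab(2,3) unfolding Y by blast
  qed
  have uniq: "a' = a" if a: "{a, v} \<in> edges G" "{a', v} \<in> edges G" "a \<in> Y" "a' \<in> Y" for a a'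
  proof (rule ccontr)
    assume ne: "a' \<noteq> a"
    have "a' \<in> reach H a" using a(3,4) reach_eq[of a H y] unfolding Y by blast
    moreover have "reach H a \<subseteq> reach (del_edges G {{a, v}}) a"
      by (rule reach_mono) (auto simp: H_def edges_induced)
    moreover have "{a', v} \<in> edges (del_edges G {{a, v}})"
      using a(2) ne by (auto simp: doubleton_eq_iff)
    ultimately have "v \<in> reach (del_edges G {{a, v}}) a" by (meson reach_step subsetD)
    then show False using nonbridge_on_cycle[OF G a(1)] ac by blast
  qed
  show "\<exists>r. branch G Y r"
  proof (cases "\<exists>a\<in>Y. {a, v} \<in> edges G")
    case True
    then obtain a where a: "a \<in> Y" "{a, v} \<in> edges G" by blast
    have "branch G Y a"
      unfolding branch_def using a YX XV conn to_v uniq by blast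
    then show ?thesis ..
  next
    case False
    have "y \<in> Y" by (simp add: Y)
    have "branch G Y y"
      unfolding branch_def using \<open>y \<in> Y\<close> YX XV conn to_v False by blast
    then show ?thesis ..
  qed
qed

text \<open>
  A whole component is a branch, so branches with at least \<open>k\<close> vertices exist. In a smallest one
  the pieces that remain without the root have fewer than \<open>k\<close> vertices, as they are smaller branches.
\<close>

lemma minimal_branch:
  assumes G: "simple_graph G" and ac: "cycles_of G = {}"
    and x: "x \<in> vertices G" "k \<le> card (reach G x)"
  obtains X v where "branch G X v" "k \<le> card X"
    "\<forall>Z\<subseteq>X - {v}. connected_graph (induced_on G Z) \<longrightarrow> card Z < k"
proof -
  define P where "P s \<longleftrightarrow> k \<le> s \<and> (\<exists>X v. branch G X v \<and> card X = s)" for s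
  have "P (card (reach G x))" using branch_component[OF G x(1)] x(2) unfolding P_def by blast
  then obtain s where s: "P s" "\<And>t. P t \<Longrightarrow> s \<le> t"
    by (metis LeastI Least_le)
  then obtain X v where X: "branch G X v" "card X = s" "k \<le> s" unfolding P_def by blast
  have XV: "X \<subseteq> vertices G" and vX: "v \<in> X" using X(1) by (auto simp: branch_def)
  have fin: "finite X" using XV finite_vertices[OF G] by (rule finite_subset)
  have "card Z < k" if Z: "Z \<subseteq> X - {v}" "connected_graph (induced_on G Z)" for Z
  proof -
    obtain z where z: "z \<in> Z" using Z(2) by (auto simp: connected_graph_iff)
    define Y where "Y = reach (induced_on G (X - {v})) z"
    have ZY: "Z \<subseteq> Y" unfolding Y_def by (rule connected_subset_reach[OF Z(2) z Z(1)])
    have YX: "Y \<subseteq> X - {v}" and "\<exists>r. branch G Y r"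
      using branch_child[OF G ac X(1), of z] z Z(1) unfolding Y_def by auto
    have "card Y < card X" by (rule psubset_card_mono[OF fin]) (use YX vX in blast)
    then have "\<not> P (card Y)" using s(2) X(2) by (metis leD)
    then have "card Y < k" using \<open>\<exists>r. branch G Y r\<close> unfolding P_def by auto
    moreover have "card Z \<le> card Y" by (rule card_mono) (use ZY YX fin in \<open>auto intro: finite_subset\<close>)
    ultimately show ?thesis by simp
  qed
  then show thesis using that X by (metis (no_types, lifting))
qed

text \<open>
  The only vertex of \<open>X\<close> with an edge to the outside is \<open>v\<close>. Hence no connected set can combine
  \<open>X - {v}\<close> with \<open>S\<close>.
\<close>

lemma gen_independent_add_branch:
  assumes G: "simple_graph G" and br: "branch G X v"
    and small: "\<And>Z. Z \<subseteq> X - {v} \<Longrightarrow> connected_graph (induced_on G Z) \<Longrightarrow> card Z < k"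
    and S: "gen_independent k (induced_on G (vertices G - X)) S"
  shows "gen_independent k G ((X - {v}) \<union> S)"
proof -
  define H where "H = induced_on G (vertices G - X)"
  have H: "simple_graph H" unfolding H_def by (rule simple_induced[OF G]) auto
  have SV: "S \<subseteq> vertices G - X" using S by (simp add: gen_independent_def)
  have "card Z \<noteq> k" if Z: "Z \<subseteq> (X - {v}) \<union> S" "connected_graph (induced_on G Z)" for Z
  proof (cases "Z \<inter> X = {}")
    case True
    then have "Z \<subseteq> S" using Z(1) by blast
    moreover have "induced_on H Z = induced_on G Z"
      unfolding H_def by (rule induced_induced) (use \<open>Z \<subseteq> S\<close> SV in blast)
    ultimately show ?thesis
      using S Z(2) unfolding H_def[symmetric] gen_independent_iff[OF H] by simp
  next
    case False
    then obtain z where z: "z \<in> Z" "z \<in> X" by blast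
    have "reach (induced_on G Z) z \<subseteq> X"
    proof (rule reach_subset_closed[OF z(2)])
      fix a b assume a: "a \<in> X" "{a, b} \<in> edges (induced_on G Z)"
      then have ab: "{a, b} \<in> edges G" "a \<in> Z" by (auto simp: edges_induced)
      have "v \<notin> Z" using Z(1) SV br unfolding branch_def by blast
      then show "b \<in> X" using br a ab unfolding branch_def by blast
    qed
    moreover have "Z \<subseteq> reach (induced_on G Z) z"
      using Z(2) z by (auto simp: connected_graph_iff)
    ultimately have "Z \<subseteq> X - {v}" using Z(1) SV br unfolding branch_def by blast
    from small[OF this Z(2)] show ?thesis by simp
  qed
  moreover have "(X - {v}) \<union> S \<subseteq> vertices G" using SV br unfolding branch_def by blast
  ultimately show ?thesis unfolding gen_independent_iff[OF G] by blast
qed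

lemma cycles_induced_subset: "simple_graph G \<Longrightarrow> W \<subseteq> vertices G \<Longrightarrow> cycles_of (induced_on G W) \<subseteq> cycles_of G"
  by (auto simp: cycles_of_def is_subgraph_def edges_induced)

abbreviation R_tree :: "nat \<Rightarrow> 'a sgraph \<Rightarrow> bool" where
  "R_tree k T \<equiv> k dvd card (vertices T) \<and> R_family k (card (vertices T) div k) T"

text \<open>
  A component of \<open>G\<close> that avoids \<open>X\<close> is a component of \<open>G - X\<close>. One that meets \<open>X\<close> contains \<open>X\<close>; it
  is either \<open>X\<close> itself or consists of \<open>X\<close>, the single edge that leaves \<open>X\<close>, and the component \<open>W\<close> of
  \<open>G - X\<close> at the other end of this edge.
\<close>

lemma R_family_add_branch:
  assumes G: "simple_graph G" and ac: "cycles_of G = {}" and k: "k \<noteq> 0"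
    and br: "branch G X v" and card: "card X = k"
    and rest: "\<And>T. T \<in> graph_components (induced_on G (vertices G - X)) \<Longrightarrow> R_tree k T"
    and T: "T \<in> graph_components G"
  shows "R_tree k T"
proof -
  define H where "H = induced_on G (vertices G - X)"
  have H: "simple_graph H" unfolding H_def by (rule simple_induced[OF G]) auto
  have VH: "vertices H = vertices G - X" by (simp add: H_def)
  obtain w where w: "\<And>a b. a \<in> X \<Longrightarrow> {a, b} \<in> edges G \<Longrightarrow> b \<notin> X \<Longrightarrow> a = v \<and> b = w"
    and X: "X \<subseteq> vertices G" "v \<in> X" "connected_graph (induced_on G X)"
    using br unfolding branch_def by blast
  have XT: "is_tree (induced_on G X)"
    using X simple_induced[OF G X(1)] cycles_induced_subset[OF G X(1)] ac by (auto simp: is_tree_def)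
  have restH: "R_tree k (induced_on G (reach H x))" if "x \<in> vertices G - X" for x
  proof -
    have "reach H x \<subseteq> vertices G - X" using reach_in_vertices[OF H] that by (simp add: VH)
    then have "induced_on H (reach H x) = induced_on G (reach H x)"
      unfolding H_def by (rule induced_induced)
    then have "induced_on G (reach H x) \<in> graph_components H"
      using that unfolding graph_components_eq[OF H] VH by (metis image_eqI)
    then show ?thesis using rest unfolding H_def[symmetric] by blast
  qed
  obtain x where x: "x \<in> vertices G" "T = induced_on G (reach G x)"
    using T by (auto simp: graph_components_eq[OF G])
  define U where "U = reach G x"
  show ?thesis
  proof (cases "U \<inter> X = {}")
    case True
    have "U \<subseteq> reach H x \<inter> U"
      unfolding U_def
    proof (rule reach_subset_closed, simp)
      fix y z assume y: "y \<in> reach H x \<inter> reach G x" "{y, z} \<in> edges G"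
      then have z: "z \<in> reach G x" using reach_step[OF _ y(2)] by blast
      then have e: "{y, z} \<in> edges H"
        using y True edge_ends[OF G y(2)] by (auto simp: H_def edges_induced U_def)
      show "z \<in> reach H x \<inter> reach G x" using y(1) z reach_step[OF _ e] by blast
    qed
    then have "reach H x = U" using reach_induced_subset[of G "vertices G - X" x] by (auto simp: U_def H_def)
    moreover have "x \<in> U" by (simp add: U_def)
    then have "x \<in> vertices G - X" using x(1) True by blast
    ultimately show ?thesis using restH[of x] x by (simp add: U_def)
  next
    case False
    then obtain p where p: "p \<in> X" "p \<in> U" by blast
    have Up: "U = reach G p" using reach_eq[of p G x] p by (simp add: U_def)
    have "X \<subseteq> reach (induced_on G X) p" using X p by (auto simp: connected_graph_iff)
    then have XU: "X \<subseteq> U" using reach_induced_subset[of G X p] by (auto simp: Up)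
    show ?thesis
    proof (cases "U = X")
      case True
      then have "T = induced_on G X" using x by (simp add: U_def)
      moreover have "R_family k 1 (induced_on G X)" by (rule R_family.base[OF XT]) (simp add: card)
      ultimately show ?thesis using card k by simp
    next
      case False
      have "\<exists>a b. a \<in> X \<and> {a, b} \<in> edges G \<and> b \<notin> X"
      proof (rule ccontr)
        assume "\<not> ?thesis"
        then have "reach G p \<subseteq> X" by (intro reach_subset_closed[OF p(1)]) blast
        then show False using False XU Up by blast
      qed
      then have vw: "{v, w} \<in> edges G" "w \<notin> X" using w by metis+
      define W where "W = reach H w"
      have wV: "w \<in> vertices G - X" using edge_ends[OF G vw(1)] vw by blast
      then have WV: "W \<subseteq> vertices G - X" unfolding W_def using reach_in_vertices[OF H] by (simp add: VH)
      have "w \<in> U" using X(2) XU reach_step[OF _ vw(1)] unfolding U_def by blast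
      then have "reach G w = U" unfolding U_def by (rule reach_eq)
      then have WU: "W \<subseteq> U" using reach_induced_subset[of G "vertices G - X" w] by (simp add: W_def H_def)
      have "reach G p \<subseteq> X \<union> W"
      proof (rule reach_subset_closed)
        fix y z assume yz: "y \<in> X \<union> W" "{y, z} \<in> edges G"
        show "z \<in> X \<union> W"
        proof (cases "y \<in> X")
          case True
          then show ?thesis using w[OF True yz(2)] reach_refl[of w H] unfolding W_def by blast
        next
          case False
          have "{y, z} \<in> edges H" if "z \<notin> X"
            using that False yz edge_ends[OF G yz(2)] by (simp add: H_def edges_induced)
          moreover have "y \<in> W" using yz False by blast
          ultimately show ?thesis unfolding W_def using reach_step[of y H w z] by blast
        qed
      qed (use p in simp)
      then have UWX: "U = W \<union> X" using XU WU Up by blast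
      have disj: "W \<inter> X = {}" using WV by blast
      have fin: "finite W" "finite X"
        using WV X(1) finite_vertices[OF G] by (auto intro: finite_subset)
      have "edges T = insert {w, v} (edges (induced_on G W) \<union> edges (induced_on G X))"
      proof (intro subset_antisym subsetI)
        fix e assume "e \<in> edges T"
        then have e: "e \<in> edges G" "e \<subseteq> W \<union> X" using x UWX by (auto simp: edges_induced U_def)
        obtain a b where ab: "e = {a, b}" using edgeE[OF G e(1)] by metis
        have ba: "{b, a} \<in> edges G" using e(1) ab by (simp add: insert_commute)
        consider "e \<subseteq> W" | "e \<subseteq> X" | "a \<in> X" "b \<notin> X" | "b \<in> X" "a \<notin> X"
          using e(2) ab by blast
        then show "e \<in> insert {w, v} (edges (induced_on G W) \<union> edges (induced_on G X))"
        proof cases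
          case 3
          then show ?thesis using w[of a b] e(1) ab by auto
        next
          case 4
          then show ?thesis using w[of b a] ba ab by auto
        qed (use e(1) in \<open>auto simp: edges_induced\<close>)
      next
        fix e assume "e \<in> insert {w, v} (edges (induced_on G W) \<union> edges (induced_on G X))"
        then show "e \<in> edges T"
          using x UWX vw X(2) \<open>w \<in> U\<close> by (auto simp: edges_induced U_def insert_commute)
      qed
      then have Teq: "T = (vertices (induced_on G W) \<union> vertices (induced_on G X),
          insert {w, v} (edges (induced_on G W) \<union> edges (induced_on G X)))"
        using x UWX by (intro prod_eqI) (auto simp: U_def)
      have RW: "k dvd card W" "R_family k (card W div k) (induced_on G W)"
        using restH[OF wV] by (auto simp: W_def)
      have "R_family k (Suc (card W div k)) T"
        unfolding Teq
        by (rule R_family.step[OF RW(2) XT]) (use card disj X(2) in \<open>auto simp: W_def\<close>)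
      moreover have "card (vertices T) = card W + k"
        using card_Un_disjoint[OF fin disj] card by (simp add: Teq)
      ultimately show ?thesis using RW(1) k by simp
    qed
  qed
qed

text \<open>
  Let \<open>X\<close> be a minimal branch, with \<open>s \<ge> k\<close> vertices. All of \<open>X\<close> but its root is added to an optimal
  set for the rest, so that \<open>s - 1 \<ge> (k - 1) s / k\<close> vertices are gained for \<open>s\<close>. If the total bound is
  attained, then \<open>s = k\<close> and it is attained for the rest.
\<close>

lemma forest_bound:
  assumes "simple_graph G" "cycles_of G = {}" "0 < k"
  shows "(k - 1) * card (vertices G) \<le> k * gen_independence_number k G \<and>
    ((k - 1) * card (vertices G) = k * gen_independence_number k G \<longrightarrow>
      (\<forall>T\<in>graph_components G. R_tree k T))"
  using assms
proof (induction "card (vertices G)" arbitrary: G rule: less_induct)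
  case less
  note G = less.prems(1) and ac = less.prems(2) and k = less.prems(3)
  obtain j where j: "k = Suc j" using k by (cases k) auto
  \<comment> \<open>If no component has \<open>k\<close> vertices, all vertices can be taken, and equality is left only for the
    empty graph.\<close>
  show ?case
  proof (cases "\<forall>x\<in>vertices G. card (reach G x) < k")
    case True
    have "gen_independent k G (vertices G)"
      unfolding gen_independent_iff[OF G]
    proof (intro conjI allI impI)
      fix Z assume Z: "Z \<subseteq> vertices G" "connected_graph (induced_on G Z)"
      then obtain z where z: "z \<in> Z" by (auto simp: connected_graph_iff)
      have "Z \<subseteq> reach G z"
        using connected_subset_reach[OF Z(2) z subset_refl] reach_induced_subset[of G Z z] by blast
      then have "card Z \<le> card (reach G z)"
        by (rule card_mono[rotated])
          (use reach_in_vertices[OF G] finite_vertices[OF G] z Z(1) in \<open>auto intro: finite_subset\<close>)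
      then show "card Z \<noteq> k" using True z Z(1) by fastforce
    qed simp
    from gen_independent_card_le[OF G this]
    have le: "card (vertices G) \<le> gen_independence_number k G" .
    have "R_tree k T" if "(k - 1) * card (vertices G) = k * gen_independence_number k G"
      "T \<in> graph_components G" for T
    proof -
      have "k * card (vertices G) \<le> (k - 1) * card (vertices G)" using le that(1) by simp
      then have "vertices G = {}" using j finite_vertices[OF G] by simp
      then show ?thesis using that(2) by (simp add: graph_components_eq[OF G])
    qed
    moreover have "(k - 1) * card (vertices G) \<le> k * gen_independence_number k G"
      by (rule mult_le_mono[OF diff_le_self le])
    ultimately show ?thesis by blast
  next
    case False
    then obtain x where x: "x \<in> vertices G" "k \<le> card (reach G x)" by (auto simp: not_less)
    obtain X v where br: "branch G X v" and Xk: "k \<le> card X"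
      and small: "\<forall>Z\<subseteq>X - {v}. connected_graph (induced_on G Z) \<longrightarrow> card Z < k"
      by (rule minimal_branch[OF G ac x])
    have X: "X \<subseteq> vertices G" "v \<in> X" using br by (auto simp: branch_def)
    define H where "H = induced_on G (vertices G - X)"
    have H: "simple_graph H" unfolding H_def by (rule simple_induced[OF G]) auto
    have acH: "cycles_of H = {}"
      using cycles_induced_subset[OF G, of "vertices G - X"] ac by (auto simp: H_def)
    have finX: "finite X" using X(1) finite_vertices[OF G] by (rule finite_subset)
    have nG: "card (vertices G) = card X + card (vertices H)"
      using card_Un_disjoint[of X "vertices G - X"] finX finite_vertices[OF G] X(1)
      by (simp add: H_def Un_absorb1)
    then have "card (vertices H) < card (vertices G)" using Xk k by simp
    note IH = less.hyps[OF this H acH k]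
    obtain S where S: "gen_independent k H S" "card S = gen_independence_number k H"
      by (rule gen_independence_number_attained[OF H])
    have SV: "S \<subseteq> vertices G - X" using S(1) by (simp add: gen_independent_def H_def)
    have "card ((X - {v}) \<union> S) \<le> gen_independence_number k G"
      by (rule gen_independent_card_le[OF G gen_independent_add_branch[OF G br]])
        (use small S(1) in \<open>auto simp: H_def\<close>)
    moreover have "card ((X - {v}) \<union> S) = card (X - {v}) + card S"
      by (rule card_Un_disjoint)
        (use finX SV finite_vertices[OF G] in \<open>auto intro: finite_subset\<close>)
    moreover have "card X = Suc (card (X - {v}))" using card_Suc_Diff1[OF finX X(2)] by simp
    ultimately have aG: "card X + gen_independence_number k H \<le> Suc (gen_independence_number k G)"
      using S(2) by simp
    define s m a b where "s = card X" and "m = card (vertices H)"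
      and "a = gen_independence_number k G" and "b = gen_independence_number k H"
    have 1: "s + b \<le> Suc a" "j * m \<le> Suc j * b" "Suc j \<le> s"
      using aG IH Xk j by (auto simp: s_def m_def a_def b_def)
    have 2: "Suc j * s + Suc j * b \<le> Suc j * Suc a"
      using mult_le_mono2[OF 1(1), of "Suc j"] by (simp only: distrib_left)
    have 3: "j * (s + m) \<le> Suc j * a" using 2 1 by (simp add: algebra_simps)
    have "s = Suc j \<and> j * m = Suc j * b" if "j * (s + m) = Suc j * a"
      using 2 1 that by (simp add: algebra_simps)
    then have eq: "card X = k \<and> (k - 1) * card (vertices H) = k * gen_independence_number k H"
      if "(k - 1) * card (vertices G) = k * gen_independence_number k G"
      using that nG by (simp add: s_def m_def a_def b_def j)
    have "R_tree k T" if T: "(k - 1) * card (vertices G) = k * gen_independence_number k G"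
        "T \<in> graph_components G" for T
    proof -
      have "R_tree k T'" if "T' \<in> graph_components (induced_on G (vertices G - X))" for T'
        using IH eq[OF T(1)] that by (simp add: H_def)
      from R_family_add_branch[OF G ac _ br _ this T(2)] eq[OF T(1)] k show ?thesis by simp
    qed
    moreover have "(k - 1) * card (vertices G) \<le> k * gen_independence_number k G"
      using 3 nG by (simp add: s_def m_def a_def b_def j)
    ultimately show ?thesis by blast
  qed
qed

section \<open>The lower bound and its equality case\<close>

definition extremal :: "nat \<Rightarrow> 'a sgraph \<Rightarrow> bool" where
  "extremal k G \<longleftrightarrow>
     (\<forall>C\<in>cycles_of G. \<forall>D\<in>cycles_of G. C \<noteq> D \<longrightarrow> vertices C \<inter> vertices D = {})
   \<and> (\<forall>C\<in>cycles_of G. [card (edges C) = 1] (mod k))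
   \<and> (\<forall>T\<in>graph_components (off_cycle_graph G). R_tree k T)"

lemma vertices_off_cycle [simp]:
  "vertices (off_cycle_graph G) = vertices G - (\<Union>C\<in>cycles_of G. vertices C)"
  by (simp add: off_cycle_graph_def)

lemma edges_off_cycle:
  "edges (off_cycle_graph G) = {e \<in> edges G. e \<subseteq> vertices (off_cycle_graph G)}"
  by (simp add: off_cycle_graph_def edges_induced)

lemma simple_off_cycle: "simple_graph G \<Longrightarrow> simple_graph (off_cycle_graph G)"
  unfolding off_cycle_graph_def by (rule simple_induced) auto

lemma off_cycle_graph_acyclic: "simple_graph G \<Longrightarrow> cycles_of G = {} \<Longrightarrow> off_cycle_graph G = G"
  by (simp add: off_cycle_graph_def induced_all)

lemma cycle_edge_subset: "C \<in> cycles_of G \<Longrightarrow> e \<in> edges C \<Longrightarrow> e \<subseteq> vertices C"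
  using cycle_facts(2)[of C G] unfolding simple_graph_def by blast

lemma cycles_del_vertex:
  assumes "simple_graph G"
  shows "cycles_of (del_vertex G v) = {C \<in> cycles_of G. v \<notin> vertices C}"
proof (intro subset_antisym subsetI)
  fix C assume C: "C \<in> cycles_of (del_vertex G v)"
  then show "C \<in> {C \<in> cycles_of G. v \<notin> vertices C}"
    using cycles_induced_subset[OF assms, of "vertices G - {v}"] cycle_facts(3)[OF C] by auto
next
  fix C assume "C \<in> {C \<in> cycles_of G. v \<notin> vertices C}"
  then have C: "C \<in> cycles_of G" "v \<notin> vertices C" by auto
  have "edges C \<subseteq> edges (del_vertex G v)"
  proof
    fix e assume e: "e \<in> edges C"
    then show "e \<in> edges (del_vertex G v)"
      using cycle_edge_subset[OF C(1) e] cycle_facts(3,4)[OF C(1)] C(2) by (auto simp: edges_induced)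
  qed
  then show "C \<in> cycles_of (del_vertex G v)"
    using cycle_facts(3)[OF C(1)] C(2) by (intro cycle_sub[OF C(1)]) auto
qed

text \<open>
  If \<open>a\<close> and \<open>b\<close> were different, one could walk from \<open>y\<close> to \<open>z\<close> off the cycles, on to \<open>b\<close>, and along
  \<open>C\<close> to \<open>a\<close>, without the edge \<open>{y, a}\<close>. Then this edge and its end \<open>y\<close> would lie on a cycle.
\<close>

lemma off_cycle_attachment_unique:
  assumes G: "simple_graph G" and C: "C \<in> cycles_of G"
    and y: "y \<in> vertices (off_cycle_graph G)" and z: "z \<in> reach (off_cycle_graph G) y"
    and a: "a \<in> vertices C" "{y, a} \<in> edges G" and b: "b \<in> vertices C" "{z, b} \<in> edges G"
  shows "a = b"
proof (rule ccontr)
  assume ne: "a \<noteq> b"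
  define H where "H = del_edges G {{y, a}}"
  define O' where "O' = off_cycle_graph G"
  have zV: "z \<in> vertices O'"
    using reach_in_vertices[OF simple_off_cycle[OF G] y] z by (auto simp: O'_def)
  have "reach O' y \<subseteq> reach H y"
    by (rule reach_mono) (use a(1) C in \<open>auto simp: O'_def H_def edges_off_cycle\<close>)
  then have 1: "z \<in> reach H y" using z by (auto simp: O'_def)
  have "z \<noteq> a" using zV a(1) C by (auto simp: O'_def)
  then have "{z, b} \<in> edges H" using b(2) ne by (auto simp: H_def doubleton_eq_iff)
  then have 2: "b \<in> reach H y" by (rule reach_step[OF 1])
  have yC: "y \<notin> vertices C" using y C by auto
  have "reach C b \<subseteq> reach H b"
  proof (rule reach_mono)
    show "edges C \<subseteq> edges H"
      using cycle_edge_subset[OF C] cycle_facts(4)[OF C] yC by (auto simp: H_def)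
  qed
  moreover have "a \<in> reach C b" using cycle_facts(1)[OF C] a(1) b(1) by (auto simp: connected_graph_iff)
  ultimately have "a \<in> reach H y" using reach_trans[OF 2] by blast
  then obtain D where D: "D \<in> cycles_of G" "{y, a} \<in> edges D"
    using nonbridge_on_cycle[OF G a(2)] by (auto simp: H_def)
  then have "y \<in> vertices D" using cycle_edge_subset[OF D] by simp
  then show False using y D(1) by auto
qed

lemma vertices_off_cycle_del_vertex:
  assumes G: "simple_graph G" and C: "C \<in> cycles_of G" and v: "v \<in> vertices C"
    and dis: "\<And>D. D \<in> cycles_of G \<Longrightarrow> D \<noteq> C \<Longrightarrow> vertices D \<inter> vertices C = {}"
  shows "vertices (off_cycle_graph (del_vertex G v)) =
    vertices (off_cycle_graph G) \<union> (vertices C - {v})"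
proof -
  have cyc: "cycles_of (del_vertex G v) = cycles_of G - {C}"
    unfolding cycles_del_vertex[OF G] using v dis by blast
  have "(\<Union>D\<in>cycles_of G - {C}. vertices D) \<inter> vertices C = {}" using dis by blast
  moreover have "(\<Union>D\<in>cycles_of G. vertices D) = (\<Union>D\<in>cycles_of G - {C}. vertices D) \<union> vertices C"
    using C by blast
  ultimately show ?thesis
    unfolding vertices_off_cycle vertices_induced cyc using cycle_facts(3)[OF C] v by blast
qed

text \<open>
  The deleted vertex is the one where \<open>T\<close> is attached to \<open>C\<close>, or any vertex of \<open>C\<close> if \<open>T\<close> is not
  attached to it. The remaining vertices of \<open>C\<close>, which lie on no cycle any more, are then not
  adjacent to \<open>T\<close> and do not enlarge it.
\<close>

lemma off_cycle_component_survives: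
  assumes G: "simple_graph G" and C: "C \<in> cycles_of G"
    and dis: "\<And>D. D \<in> cycles_of G \<Longrightarrow> D \<noteq> C \<Longrightarrow> vertices D \<inter> vertices C = {}"
    and T: "T \<in> graph_components (off_cycle_graph G)"
  shows "\<exists>v\<in>vertices C. T \<in> graph_components (off_cycle_graph (del_vertex G v))"
proof -
  define O1 where "O1 = off_cycle_graph G"
  have O1: "simple_graph O1" unfolding O1_def by (rule simple_off_cycle[OF G])
  obtain x where x: "x \<in> vertices O1" "T = induced_on O1 (reach O1 x)"
    using T unfolding O1_def[symmetric] graph_components_eq[OF O1] by blast
  define U where "U = reach O1 x"
  have UV: "U \<subseteq> vertices O1" unfolding U_def by (rule reach_in_vertices[OF O1 x(1)])
  have TU: "T = induced_on G U"
    using x(2) UV unfolding U_def O1_def off_cycle_graph_def by (simp add: induced_induced)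
  obtain v where v: "v \<in> vertices C" "\<And>y a. y \<in> U \<Longrightarrow> a \<in> vertices C \<Longrightarrow> {y, a} \<in> edges G \<Longrightarrow> a = v"
  proof (cases "\<exists>y\<in>U. \<exists>a\<in>vertices C. {y, a} \<in> edges G")
    case True
    then obtain y a where ya: "y \<in> U" "a \<in> vertices C" "{y, a} \<in> edges G" by blast
    have "b = a" if "z \<in> U" "b \<in> vertices C" "{z, b} \<in> edges G" for z b
    proof -
      have "z \<in> reach O1 y" using that(1) ya(1) reach_eq[of y O1 x] unfolding U_def by blast
      then show ?thesis
        using off_cycle_attachment_unique[OF G C, of y z a b] ya that UV unfolding O1_def by blast
    qed
    then show thesis using that[of a] ya(2) by blast
  next
    case False
    obtain c where "c \<in> vertices C" using cycle_facts(1)[OF C] by (auto simp: connected_graph_iff)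
    then show thesis using that[of c] False by blast
  qed
  define O2 where "O2 = off_cycle_graph (del_vertex G v)"
  have DV: "simple_graph (del_vertex G v)" by (rule simple_induced[OF G]) auto
  have O2: "simple_graph O2" unfolding O2_def by (rule simple_off_cycle[OF DV])
  have V2: "vertices O2 = vertices O1 \<union> (vertices C - {v})"
    unfolding O1_def O2_def by (rule vertices_off_cycle_del_vertex[OF G C v(1) dis])
  have E1: "edges O1 = {e \<in> edges G. e \<subseteq> vertices O1}"
    unfolding O1_def by (rule edges_off_cycle)
  have VG: "vertices O2 \<subseteq> vertices G - {v}" unfolding O2_def vertices_off_cycle vertices_induced by blast
  have E2: "edges O2 = {e \<in> edges G. e \<subseteq> vertices O2}"
    using VG unfolding O2_def edges_off_cycle[of "del_vertex G v"] edges_induced by blast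
  have "reach O2 x \<subseteq> U"
  proof (rule reach_subset_closed)
    fix y z assume y: "y \<in> U" and e: "{y, z} \<in> edges O2"
    have eG: "{y, z} \<in> edges G" and z: "z \<in> vertices O2" using e E2 by auto
    have "z \<in> vertices O1" using v(2)[OF y _ eG] z V2 by blast
    then have "{y, z} \<in> edges O1" using E1 eG y UV by auto
    then show "z \<in> U" using reach_step[of y O1 x z] y unfolding U_def by blast
  qed (simp add: U_def)
  moreover have "U \<subseteq> reach O2 x"
    unfolding U_def by (rule reach_mono) (use E1 E2 V2 in auto)
  ultimately have "reach O2 x = U" by blast
  moreover have "induced_on O2 U = induced_on G U"
    using UV V2 E2 by (auto simp: induced_on_def)
  moreover have "x \<in> vertices O2" using x(1) V2 by blast
  ultimately have "T \<in> graph_components O2"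
    unfolding graph_components_eq[OF O2] TU by (metis image_eqI)
  then show ?thesis using v(1) unfolding O2_def by blast
qed

lemma disjoint_reach_classes:
  assumes "A \<in> reach G ` W" "B \<in> reach G ` W" "A \<noteq> B"
  shows "A \<inter> B = {}"
proof (rule ccontr)
  assume "A \<inter> B \<noteq> {}"
  then obtain z where z: "z \<in> A" "z \<in> B" by blast
  obtain a b where ab: "A = reach G a" "B = reach G b" using assms by blast
  have "reach G z = A" "reach G z = B" using z reach_eq unfolding ab by metis+
  then show False using assms(3) by simp
qed

lemma Union_reach: "simple_graph G \<Longrightarrow> \<Union>(reach G ` vertices G) = vertices G"
  using reach_in_vertices[of G] reach_refl[of _ G] by blast

lemma dvd_card_vertices:
  assumes G: "simple_graph G" and c: "\<And>T. T \<in> graph_components G \<Longrightarrow> k dvd card (vertices T)"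
  shows "k dvd card (vertices G)"
proof -
  have "k dvd card (\<Union>(reach G ` vertices G))"
  proof (rule dvd_partition)
    show "finite (\<Union>(reach G ` vertices G))" using G by (simp add: Union_reach finite_vertices)
    show "\<forall>c\<in>reach G ` vertices G. k dvd card c"
      using c unfolding graph_components_eq[OF G] by fastforce
    show "\<forall>A\<in>reach G ` vertices G. \<forall>B\<in>reach G ` vertices G. A \<noteq> B \<longrightarrow> A \<inter> B = {}"
      by (intro ballI impI) (rule disjoint_reach_classes)
  qed
  then show ?thesis by (simp add: Union_reach G)
qed

lemma card_del_vertex: "simple_graph G \<Longrightarrow> v \<in> vertices G \<Longrightarrow>
    int (card (vertices (del_vertex G v))) = int (card (vertices G)) - 1"
  using card_Suc_Diff1[OF finite_vertices] by fastforce

text \<open>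
  Let \<open>\<Gamma>\<close> and \<open>\<Gamma>'\<close> be the graphs of vertices off the cycles before and after the deletion of a vertex
  \<open>v\<close> of \<open>C\<close>. Conditions on \<open>\<Gamma>\<close> come from those on \<open>\<Gamma>'\<close> for a suitable \<open>v\<close>. The length
  of \<open>C\<close> follows by counting, since \<open>\<Gamma>'\<close> has the vertices of \<open>\<Gamma>\<close> and those of \<open>C - v\<close>.
\<close>

lemma extremal_step:
  assumes G: "simple_graph G" and k: "0 < k"
    and dis: "\<And>C D. C \<in> cycles_of G \<Longrightarrow> D \<in> cycles_of G \<Longrightarrow> C \<noteq> D \<Longrightarrow> vertices C \<inter> vertices D = {}"
    and C0: "C0 \<in> cycles_of G"
    and ext: "\<And>C v. C \<in> cycles_of G \<Longrightarrow> v \<in> vertices C \<Longrightarrow> extremal k (del_vertex G v)"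
  shows "extremal k G"
proof -
  have comp: "R_tree k T" if "T \<in> graph_components (off_cycle_graph G)" for T
    using off_cycle_component_survives[OF G C0 _ that] dis C0 ext[OF C0]
    unfolding extremal_def by meson
  have "[card (edges C) = 1] (mod k)" if C: "C \<in> cycles_of G" for C
  proof -
    obtain v where v: "v \<in> vertices C" using cycle_facts(1)[OF C] by (auto simp: connected_graph_iff)
    define O1 where "O1 = off_cycle_graph G"
    define O2 where "O2 = off_cycle_graph (del_vertex G v)"
    have DV: "simple_graph (del_vertex G v)" by (rule simple_induced[OF G]) auto
    have O1: "simple_graph O1" unfolding O1_def by (rule simple_off_cycle[OF G])
    have O2: "simple_graph O2" unfolding O2_def by (rule simple_off_cycle[OF DV])
    have d1: "k dvd card (vertices O1)"
      by (rule dvd_card_vertices[OF O1]) (use comp in \<open>auto simp: O1_def\<close>)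
    have d2: "k dvd card (vertices O2)"
      by (rule dvd_card_vertices[OF O2]) (use ext[OF C v] in \<open>auto simp: O2_def extremal_def\<close>)
    have V2: "vertices O2 = vertices O1 \<union> (vertices C - {v})"
      unfolding O1_def O2_def
      by (rule vertices_off_cycle_del_vertex[OF G C v]) (use dis C in blast)
    have finC: "finite (vertices C)" by (rule finite_vertices[OF cycle_facts(2)[OF C]])
    have "card (vertices O2) = card (vertices O1) + card (vertices C - {v})"
      unfolding V2
    proof (rule card_Un_disjoint)
      show "finite (vertices O1)" by (rule finite_vertices[OF O1])
      show "finite (vertices C - {v})" using finC by simp
      show "vertices O1 \<inter> (vertices C - {v}) = {}" using C unfolding O1_def vertices_off_cycle by blast
    qed
    then have "k dvd card (vertices C - {v})" using d1 d2 by (metis dvd_add_right_iff)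
    then obtain q where "card (vertices C - {v}) = k * q" ..
    then have "card (edges C) = Suc (k * q)"
      using cycle_facts(5)[OF C] card_Suc_Diff1[OF finC v] by simp
    then show ?thesis by (simp add: cong_def mod_Suc)
  qed
  then show ?thesis using dis comp unfolding extremal_def by blast
qed

text \<open>
  Deleting a cycle vertex \<open>v\<close> does not lower \<open>n - \<omega>\<close>. Hence the bound for \<open>G - v\<close> implies the one for
  \<open>G\<close>; if the latter is attained, so is the former, and \<open>\<omega>\<close> drops by exactly one.
\<close>

lemma gen_independence_lower_bound:
  assumes "simple_graph G" "2 \<le> k"
  shows "(int k - 1) * (int (card (vertices G)) - cyclomatic G) \<le> int k * int (gen_independence_number k G) \<and>
    (int k * int (gen_independence_number k G) = (int k - 1) * (int (card (vertices G)) - cyclomatic G)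
      \<longrightarrow> extremal k G)"
  using assms
proof (induction "card (vertices G)" arbitrary: G rule: less_induct)
  case less
  note G = less.prems(1) and k = less.prems(2)
  define n a w where "n = int (card (vertices G))" and "a = int (gen_independence_number k G)"
    and "w = cyclomatic G"
  have k1: "0 < int k - 1" using k by simp
  show ?case
  proof (cases "cycles_of G = {}")
    case True
    have "int ((k - 1) * card (vertices G)) = (int k - 1) * n"
      using k by (simp add: n_def of_nat_diff)
    moreover have "int (k * gen_independence_number k G) = int k * a" by (simp add: a_def)
    moreover note forest_bound[OF G True, of k] k
    ultimately have le: "(int k - 1) * n \<le> int k * a"
      and eq: "(int k - 1) * n = int k * a \<Longrightarrow> \<forall>T\<in>graph_components G. R_tree k T"
      by (metis of_nat_le_iff less_le_trans zero_less_numeral, metis of_nat_eq_iff less_le_trans zero_less_numeral)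
    have "0 \<le> w" unfolding w_def by (rule cyclomatic_nonneg[OF G])
    then have le2: "(int k - 1) * (n - w) \<le> (int k - 1) * n" using k1 by simp
    have "extremal k G" if "int k * a = (int k - 1) * (n - w)"
    proof -
      have "(int k - 1) * n = int k * a" using le le2 that by linarith
      then show ?thesis using eq True by (simp add: extremal_def off_cycle_graph_acyclic[OF G])
    qed
    then show ?thesis using le le2 unfolding n_def a_def w_def by linarith
  next
    case False
    then obtain C0 where C0: "C0 \<in> cycles_of G" by blast
    have del: "(int k - 1) * (n - 1 - cyclomatic (del_vertex G v)) \<le> int k * a \<and>
        (int k * a = (int k - 1) * (n - 1 - cyclomatic (del_vertex G v)) \<longrightarrow> extremal k (del_vertex G v))"
      if v: "v \<in> vertices G" for v
    proof -
      define H where "H = del_vertex G v"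
      have H: "simple_graph H" unfolding H_def by (rule simple_induced[OF G]) auto
      have n: "int (card (vertices H)) = n - 1"
        unfolding H_def n_def by (rule card_del_vertex[OF G v])
      then have "card (vertices H) < card (vertices G)" by (simp add: n_def)
      note IH = less.hyps[OF this H k, unfolded n]
      have "gen_independence_number k H \<le> gen_independence_number k G"
        unfolding H_def by (rule gen_independence_number_induced[OF G]) auto
      then have "int k * int (gen_independence_number k H) \<le> int k * a"
        unfolding a_def by (intro mult_left_mono) auto
      then show ?thesis using IH unfolding H_def by linarith
    qed
    have mono: "(int k - 1) * (n - w) \<le> (int k - 1) * (n - 1 - cyclomatic (del_vertex G v))"
      if "C \<in> cycles_of G" "v \<in> vertices C" for C v
      using cyclomatic_del_cycle_vertex[OF G that] k1 unfolding w_def by (intro mult_left_mono) auto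
    have onG: "v \<in> vertices G" if "C \<in> cycles_of G" "v \<in> vertices C" for C v
      using cycle_facts(3)[OF that(1)] that(2) by blast
    obtain c where c: "c \<in> vertices C0" using cycle_facts(1)[OF C0] by (auto simp: connected_graph_iff)
    have le: "(int k - 1) * (n - w) \<le> int k * a"
      using mono[OF C0 c] del[OF onG[OF C0 c]] by linarith
    have "extremal k G" if eq: "int k * a = (int k - 1) * (n - w)"
    proof (rule extremal_step[OF G _ _ C0])
      show "0 < k" using k by simp
      show "vertices C \<inter> vertices D = {}" if CD: "C \<in> cycles_of G" "D \<in> cycles_of G" "C \<noteq> D" for C D
      proof (rule ccontr)
        assume "vertices C \<inter> vertices D \<noteq> {}"
        then obtain v where v: "v \<in> vertices C \<union> vertices D" "cyclomatic (del_vertex G v) \<le> w - 2"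
          using intersecting_cycles[OF G CD] unfolding w_def by blast
        have "v \<in> vertices G" using v(1) onG CD by blast
        \<comment> \<open>Here \<open>\<omega>\<close> drops by more than \<open>n\<close> does, so the bound from \<open>G - v\<close> is too large for equality.\<close>
        have "(int k - 1) * (n - w) < (int k - 1) * (n - 1 - cyclomatic (del_vertex G v))"
          using v(2) k1 by (intro mult_strict_left_mono) auto
        then show False using del[OF \<open>v \<in> vertices G\<close>] eq by linarith
      qed
      show "extremal k (del_vertex G v)" if "C \<in> cycles_of G" "v \<in> vertices C" for C v
        using mono[OF that] del[OF onG[OF that]] eq by linarith
    qed
    then show ?thesis using le unfolding n_def a_def w_def by blast
  qed
qed

section \<open>The upper bound for extremal graphs\<close>

text \<open>
  The tree is assembled from \<open>i\<close> trees on \<open>k\<close> vertices, none of which lies entirely in \<open>S\<close>.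
\<close>

lemma R_family_gen_independent:
  assumes "R_family k i T" "simple_graph G" "vertices T \<subseteq> vertices G" "edges T \<subseteq> edges G"
    and S: "gen_independent k G S"
  shows "card (S \<inter> vertices T) \<le> i * (k - 1)"
proof -
  have tree: "card (S \<inter> vertices T) \<le> k - 1"
    if T: "is_tree T" "card (vertices T) = k" "edges T \<subseteq> edges G" for T
  proof (cases "vertices T \<subseteq> S")
    case True
    moreover have sT: "simple_graph T" using T(1) by (simp add: is_tree_def)
    then have "e \<subseteq> vertices T" if "e \<in> edges T" for e using that by (simp add: simple_graph_def)
    ultimately have "edges T \<subseteq> edges (induced_on G S)"
      using T(3) unfolding edges_induced by blast
    then have "is_subgraph T (induced_on G S)"
      using True sT unfolding is_subgraph_def by simp
    then show ?thesis using S T(1,2) unfolding gen_independent_def by blast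
  next
    case False
    have "finite (vertices T)" using T(1) by (simp add: is_tree_def simple_graph_def)
    then have "card (S \<inter> vertices T) < card (vertices T)"
      using False by (intro psubset_card_mono) auto
    then show ?thesis using T(2) by simp
  qed
  show ?thesis using assms(1,3,4)
  proof (induction rule: R_family.induct)
    case (base T)
    then show ?case using tree by simp
  next
    case (step i T' T'' u v)
    have "card (S \<inter> (vertices T' \<union> vertices T'')) \<le> card (S \<inter> vertices T') + card (S \<inter> vertices T'')"
      unfolding Int_Un_distrib by (rule card_Un_le)
    moreover have "card (S \<inter> vertices T') \<le> i * (k - 1)" using step by simp
    moreover have "card (S \<inter> vertices T'') \<le> k - 1" using step tree by simp
    ultimately show ?case by simp
  qed
qed

lemma off_cycle_gen_independent:
  assumes G: "simple_graph G" and S: "gen_independent k G S" and k: "0 < k"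
    and T: "\<And>T. T \<in> graph_components (off_cycle_graph G) \<Longrightarrow> R_tree k T"
  shows "k * card (S \<inter> vertices (off_cycle_graph G)) \<le> (k - 1) * card (vertices (off_cycle_graph G))"
proof -
  define O1 where "O1 = off_cycle_graph G"
  define P where "P = reach O1 ` vertices O1"
  have O1: "simple_graph O1" unfolding O1_def by (rule simple_off_cycle[OF G])
  have fin: "finite P" using finite_vertices[OF O1] by (simp add: P_def)
  have UV: "U \<subseteq> vertices O1" if "U \<in> P" for U using that reach_in_vertices[OF O1] by (auto simp: P_def)
  have finU: "finite U" if "U \<in> P" for U using UV[OF that] finite_vertices[OF O1] by (rule finite_subset)
  have un: "\<Union>P = vertices O1" unfolding P_def by (rule Union_reach[OF O1])
  have disj: "A \<inter> B = {}" if "A \<in> P" "B \<in> P" "A \<noteq> B" for A B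
    using that unfolding P_def by (rule disjoint_reach_classes)
  have part: "k * card (S \<inter> U) \<le> (k - 1) * card U" if U: "U \<in> P" for U
  proof -
    have "induced_on O1 U \<in> graph_components O1"
      using U unfolding graph_components_eq[OF O1] P_def by blast
    then have R: "k dvd card U" "R_family k (card U div k) (induced_on O1 U)"
      using T[of "induced_on O1 U"] unfolding O1_def by auto
    have "card (S \<inter> vertices (induced_on O1 U)) \<le> card U div k * (k - 1)"
    proof (rule R_family_gen_independent[OF R(2) G _ _ S])
      show "vertices (induced_on O1 U) \<subseteq> vertices G" using UV[OF U] by (auto simp: O1_def)
      show "edges (induced_on O1 U) \<subseteq> edges G" by (auto simp: O1_def edges_induced off_cycle_graph_def)
    qed
    then have "k * card (S \<inter> U) \<le> k * (card U div k * (k - 1))" by simp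
    also have "\<dots> = (k * (card U div k)) * (k - 1)" by (simp only: mult.assoc)
    also have "\<dots> = (k - 1) * card U" using R(1) by (simp add: mult.commute)
    finally show ?thesis .
  qed
  have "S \<inter> vertices O1 = (\<Union>U\<in>P. S \<inter> U)" using un by blast
  also have "card \<dots> = (\<Sum>U\<in>P. card (S \<inter> U))"
    by (rule card_UN_disjoint[OF fin]) (use finU disj in \<open>blast+\<close>)
  finally have "k * card (S \<inter> vertices O1) = (\<Sum>U\<in>P. k * card (S \<inter> U))" by (simp add: sum_distrib_left)
  also have "\<dots> \<le> (\<Sum>U\<in>P. (k - 1) * card U)" by (rule sum_mono[OF part])
  also have "\<dots> = (k - 1) * card (\<Union>U\<in>P. U)"
    using card_UN_disjoint[OF fin, of "\<lambda>U. U"] finU disj by (simp add: sum_distrib_left)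
  finally show ?thesis using un unfolding O1_def by simp
qed

lemma inj_on_shift_mod: "inj_on (\<lambda>j. (i + j) mod l) {..<l}" for l :: nat
proof (rule inj_onI)
  fix a b assume ab: "a \<in> {..<l}" "b \<in> {..<l}" "(i + a) mod l = (i + b) mod l"
  then have "[a = b] (mod l)" using cong_add_lcancel_nat unfolding cong_def by blast
  then show "a = b" using ab by (simp add: cong_def)
qed

text \<open>
  Each of the \<open>l = k q + 1\<close> windows of \<open>k\<close> consecutive vertices is connected, so it contains a vertex
  outside \<open>S\<close>; and every vertex lies in \<open>k\<close> windows. Counting in two ways shows that \<open>k\<close> times the number of
  vertices outside \<open>S\<close> is at least \<open>k q + 1\<close>, which makes this number at least \<open>q + 1\<close>.
\<close>

lemma cycle_gen_independent:
  assumes G: "simple_graph G" and S: "gen_independent k G S" and k: "2 \<le> k"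
    and C: "C \<in> cycles_of G" and c: "[card (edges C) = 1] (mod k)"
  shows "k * card (S \<inter> vertices C) + (k - 1) \<le> (k - 1) * card (vertices C)"
proof -
  obtain vs where vs: "3 \<le> length vs" "distinct vs" "C = cycle_graph vs"
    using C by (auto simp: cycles_of_def)
  define l where "l = length vs"
  have l: "3 \<le> l" "card (vertices C) = l" using vs by (simp_all add: l_def distinct_card)
  have ne: "vs \<noteq> []" using vs by auto
  have lt: "m mod l < l" for m using l(1) by simp
  have "l mod k = 1" using c cycle_facts(5)[OF C] l k by (simp add: cong_def)
  then obtain q where q: "l = k * q + 1" by (metis mult_div_mod_eq)
  have q1: "1 \<le> q" using q l by (cases q) auto
  have "k * 1 \<le> k * q" by (rule mult_le_mono2[OF q1])
  then have kl: "k < l" using q by linarith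
  define f where "f i = (if vs ! i \<in> S then 0 else 1 :: nat)" for i
  have window: "1 \<le> (\<Sum>j<k. f ((i + j) mod l))" for i
  proof (rule ccontr)
    assume "\<not> ?thesis"
    then have "(\<Sum>j<k. f ((i + j) mod l)) = 0" by linarith
    then have inS: "vs ! ((i + j) mod l) \<in> S" if "j < k" for j
      using that by (auto simp: f_def split: if_splits)
    define W where "W = (\<lambda>j. vs ! ((i + j) mod l)) ` {..<k}"
    have WS: "W \<subseteq> S" using inS by (auto simp: W_def)
    have inW: "vs ! ((i + t) mod l) \<in> W" if "t < k" for t
      unfolding W_def by (rule imageI) (use that in simp)
    have "inj_on (\<lambda>j. vs ! ((i + j) mod l)) {..<k}"
    proof (rule inj_onI)
      fix a b assume ab: "a \<in> {..<k}" "b \<in> {..<k}" "vs ! ((i + a) mod l) = vs ! ((i + b) mod l)"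
      then have "(i + a) mod l = (i + b) mod l"
        using nth_eq_iff_index_eq[OF vs(2) lt[unfolded l_def] lt[unfolded l_def]] by (simp add: l_def)
      then show "a = b" by (rule inj_onD[OF inj_on_shift_mod]) (use ab(1,2) kl in auto)
    qed
    then have cW: "card W = k" by (simp add: W_def card_image)
    have "connected_graph (induced_on G W)"
    proof (rule connected_graphI)
      show "vs ! (i mod l) \<in> vertices (induced_on G W)" using inW[of 0] k by simp
      show "vertices (induced_on G W) \<subseteq> reach (induced_on G W) (vs ! (i mod l))"
      proof
        fix x assume "x \<in> vertices (induced_on G W)"
        then obtain j where j: "j < k" "x = vs ! ((i + j) mod l)" by (auto simp: W_def)
        have "vs ! ((i + j) mod length vs) \<in> reach (induced_on G W) (vs ! (i mod length vs))"
        proof (rule cycle_walk[OF ne])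
          fix m assume m: "m < j"
          have "{vs ! ((i + m) mod l), vs ! ((i + Suc m) mod l)} \<in> edges C"
            using cycle_edge[OF ne, of "i + m"] vs(3) by (simp add: l_def)
          moreover have "{vs ! ((i + m) mod l), vs ! ((i + Suc m) mod l)} \<subseteq> W"
            using inW[of m] inW[of "Suc m"] m j(1) by simp
          ultimately show "{vs ! ((i + m) mod length vs), vs ! ((i + Suc m) mod length vs)} \<in> edges (induced_on G W)"
            using cycle_facts(4)[OF C] by (auto simp: edges_induced l_def)
        qed
        then show "x \<in> reach (induced_on G W) (vs ! (i mod l))" using j by (simp add: l_def)
      qed
    qed
    then show False using S WS cW unfolding gen_independent_iff[OF G] by blast
  qed
  \<comment> \<open>Position \<open>j\<close> of the window runs once around the cycle as the window does.\<close>
  have rot: "(\<Sum>i<l. f ((i + j) mod l)) = (\<Sum>i<l. f i)" for j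
  proof -
    have inj: "inj_on (\<lambda>i. (i + j) mod l) {..<l}" using inj_on_shift_mod[of j l] by (simp add: add.commute)
    have "(\<lambda>i. (i + j) mod l) ` {..<l} = {..<l}"
      by (rule endo_inj_surj[OF _ _ inj]) (use l in auto)
    then have "bij_betw (\<lambda>i. (i + j) mod l) {..<l} {..<l}" using inj by (simp add: bij_betw_def)
    then show ?thesis by (rule sum.reindex_bij_betw)
  qed
  have "l \<le> (\<Sum>i<l. \<Sum>j<k. f ((i + j) mod l))"
    using sum_mono[of "{..<l}" "\<lambda>_. 1" "\<lambda>i. \<Sum>j<k. f ((i + j) mod l)"] window by simp
  also have "\<dots> = (\<Sum>j<k. \<Sum>i<l. f ((i + j) mod l))" by (rule sum.swap)
  also have "\<dots> = k * (\<Sum>i<l. f i)" by (simp add: rot)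
  also have "(\<Sum>i<l. f i) = (\<Sum>x\<in>vertices C. if x \<in> S then 0 else 1)"
  proof -
    have "bij_betw (\<lambda>i. vs ! i) {..<l} (vertices C)"
      using bij_betw_nth[OF vs(2) refl, of "set vs"] by (simp add: vs(3) l_def)
    from sum.reindex_bij_betw[OF this, of "\<lambda>x. if x \<in> S then 0 else 1"] show ?thesis by (simp add: f_def)
  qed
  also have "\<dots> = card (vertices C - S)"
    using finite_vertices[OF cycle_facts(2)[OF C]] by (simp add: sum.If_cases Diff_eq)
  finally have miss: "k * q + 1 \<le> k * card (vertices C - S)" using q by simp
  have "q < card (vertices C - S)"
  proof (rule ccontr)
    assume "\<not> ?thesis"
    then have "k * card (vertices C - S) \<le> k * q" by (intro mult_le_mono2) simp
    then show False using miss by linarith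
  qed
  moreover have "card (vertices C) = card (S \<inter> vertices C) + card (vertices C - S)"
    using card_Int_Diff[OF finite_vertices[OF cycle_facts(2)[OF C]], of S] by (simp add: Int_commute)
  ultimately have "card (S \<inter> vertices C) + q + 1 \<le> k * q + 1"
    using l(2) q by linarith
  then have "card (S \<inter> vertices C) \<le> (k - 1) * q" by (simp add: diff_mult_distrib)
  then have "k * card (S \<inter> vertices C) \<le> k * ((k - 1) * q)" by simp
  moreover have "k * ((k - 1) * q) + (k - 1) = (k - 1) * l"
    unfolding q by (simp add: distrib_left mult.left_commute)
  ultimately show ?thesis unfolding l(2) by (metis add_le_mono1)
qed

text \<open>
  The vertices are split into those off the cycles and the disjoint cycles. Each cycle contributes a
  defect of \<open>k - 1\<close> in addition, and the number of cycles is at least \<open>\<omega>\<close>.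
\<close>

lemma extremal_upper_bound:
  assumes G: "simple_graph G" and k: "2 \<le> k" and ext: "extremal k G"
  shows "int k * int (gen_independence_number k G) \<le>
    (int k - 1) * (int (card (vertices G)) - cyclomatic G)"
proof -
  obtain S where S: "gen_independent k G S" "card S = gen_independence_number k G"
    by (rule gen_independence_number_attained[OF G])
  have SV: "S \<subseteq> vertices G" using S(1) by (simp add: gen_independent_def)
  define P where "P = cycles_of G"
  define O1 where "O1 = off_cycle_graph G"
  have fin: "finite P" unfolding P_def by (rule finite_cycles[OF G])
  have finC: "finite (vertices C)" if "C \<in> P" for C
    using that finite_vertices[OF cycle_facts(2)] unfolding P_def by blast
  have disj: "vertices C \<inter> vertices D = {}" if "C \<in> P" "D \<in> P" "C \<noteq> D" for C D
    using ext that unfolding extremal_def P_def by blast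
  have cyc: "k * card (S \<inter> vertices C) + (k - 1) \<le> (k - 1) * card (vertices C)" if "C \<in> P" for C
    by (rule cycle_gen_independent[OF G S(1) k]) (use that ext in \<open>auto simp: P_def extremal_def\<close>)
  have off: "k * card (S \<inter> vertices O1) \<le> (k - 1) * card (vertices O1)"
    unfolding O1_def
    by (rule off_cycle_gen_independent[OF G S(1)]) (use k ext in \<open>auto simp: extremal_def\<close>)
  have split: "card (A \<inter> vertices G) = card (A \<inter> vertices O1) + (\<Sum>C\<in>P. card (A \<inter> vertices C))" for A
  proof -
    have "A \<inter> vertices G = (A \<inter> vertices O1) \<union> (\<Union>C\<in>P. A \<inter> vertices C)"
      using cycle_facts(3)[of _ G] unfolding O1_def P_def vertices_off_cycle by blast
    also have "card \<dots> = card (A \<inter> vertices O1) + card (\<Union>C\<in>P. A \<inter> vertices C)"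
    proof (rule card_Un_disjoint)
      show "finite (A \<inter> vertices O1)" using finite_vertices[OF simple_off_cycle[OF G]] by (simp add: O1_def)
      show "finite (\<Union>C\<in>P. A \<inter> vertices C)" using fin finC by simp
      show "A \<inter> vertices O1 \<inter> (\<Union>C\<in>P. A \<inter> vertices C) = {}"
        unfolding O1_def P_def vertices_off_cycle by blast
    qed
    also have "card (\<Union>C\<in>P. A \<inter> vertices C) = (\<Sum>C\<in>P. card (A \<inter> vertices C))"
      by (rule card_UN_disjoint[OF fin]) (use finC disj in \<open>blast+\<close>)
    finally show ?thesis .
  qed
  have "k * card S + (k - 1) * card P =
      k * card (S \<inter> vertices O1) + (\<Sum>C\<in>P. k * card (S \<inter> vertices C) + (k - 1))"
    using split[of S] SV by (simp add: Int_absorb2 distrib_left sum_distrib_left sum.distrib)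
  also have "\<dots> \<le> (k - 1) * card (vertices O1) + (\<Sum>C\<in>P. (k - 1) * card (vertices C))"
    by (rule add_mono[OF off sum_mono[OF cyc]])
  also have "\<dots> = (k - 1) * card (vertices G)"
    using split[of UNIV] by (simp add: distrib_left sum_distrib_left)
  finally have "int (k * card S + (k - 1) * card P) \<le> int ((k - 1) * card (vertices G))"
    unfolding of_nat_le_iff .
  then have "int k * int (card S) \<le> (int k - 1) * (int (card (vertices G)) - int (card P))"
    using k by (cases k) (simp_all add: algebra_simps)
  also have "\<dots> \<le> (int k - 1) * (int (card (vertices G)) - cyclomatic G)"
    using cyclomatic_le_card_cycles[OF G] k unfolding P_def by (intro mult_left_mono) auto
  finally show ?thesis using S(2) by simp
qed

theorem theorem1p3:
  fixes G :: "'a sgraph" and k n :: nat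
  assumes "k \<ge> 2"
    and "simple_graph G"
    and "card (vertices G) = n"
    and "n \<ge> k"
  shows "real (gen_independence_number k G)
           \<ge> (real k - 1) / real k * (real n - real_of_int (cyclomatic G))
       \<and> (real (gen_independence_number k G)
           = (real k - 1) / real k * (real n - real_of_int (cyclomatic G))
         \<longleftrightarrow>
           (\<forall>C\<in>cycles_of G. \<forall>D\<in>cycles_of G. C \<noteq> D \<longrightarrow> vertices C \<inter> vertices D = {})
         \<and> (\<forall>C\<in>cycles_of G. [card (edges C) = 1] (mod k))
         \<and> (\<forall>T\<in>graph_components (off_cycle_graph G).
              k dvd card (vertices T) \<and> R_family k (card (vertices T) div k) T))"
proof -
  define a L where "a = int k * int (gen_independence_number k G)"
    and "L = (int k - 1) * (int (card (vertices G)) - cyclomatic G)"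
  have lower: "L \<le> a" "a = L \<Longrightarrow> extremal k G"
    using gen_independence_lower_bound[OF assms(2,1)] by (auto simp: a_def L_def)
  have upper: "extremal k G \<Longrightarrow> a \<le> L"
    using extremal_upper_bound[OF assms(2,1)] by (simp add: a_def L_def)
  have k: "real k > 0" using assms(1) by simp
  have L: "(real k - 1) / real k * (real n - real_of_int (cyclomatic G)) = real_of_int L / real k"
    using assms(3) by (simp add: L_def)
  have a: "real (gen_independence_number k G) = real_of_int a / real k"
    using k by (simp add: a_def)
  have "a = L \<longleftrightarrow> extremal k G" using lower upper by fastforce
  then show ?thesis
    unfolding L a extremal_def[symmetric] using lower(1) k by (simp add: divide_right_mono)
qed

end
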